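(* Consider the min-max and max-min dynamic programs of the one-sided-information game described in the context. At each time $t$: 1. The min-max value function $V_t^u$ and the max-min value function $V_t^l$ are identical. Consequently, the functions $w_t^u$ and $w_t^l$ are also identical. Let $V_t:=V_t^l=V_t^u$ and $w_t:=w_t^u=w_t^l$. 2. There exists a finite collection $\mathcal A_t$ of vectors of size $|\mathcal X_t|$ such that $V_t(\pi_t)=\max_{\ell\in\mathcal A_t}\langle\ell,\pi_t\rangle$ for every $\pi_t\in\Delta\mathcal X_t$. Consequently, the value functions are piecewise linear and convex functions of the belief $\pi_t$. 3. The function $w_t(\pi_t,\gamma_t^1,\gamma_t^2)$ is linear in $\gamma_t^2$ for any given $\pi_t,\gamma_t^1$, and it is convex in $\gamma_t^1$ for any given $\pi_t,\gamma_t^2$.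
   Context: $\Delta\mathcal A$ is the probability simplex over a finite set $\mathcal A$. **System.** Fix a horizon $T$ and finite sets $\mathcal X_t$ (states), $\mathcal U_t^1,\mathcal U_t^2$ (actions of the minimizing player 1 and maximizing player 2), $\mathcal Y_t^2$ (observations of player 2). The state evolves as $X_{t+1}=f_t(X_t,U_t^1,U_t^2,W_t^s)$, and $Y_{t+1}^2=h_{t+1}^2(X_{t+1},U_t^1,U_t^2,W_{t+1}^2)$, where $X_1,W_t^s,W_t^2$ take finitely many values and are mutually independent; $c_t:\mathcal X_t\times\mathcal U_t^1\times\mathcal U_t^2\to\mathbb R$ is the cost at time $t$. (Player 1's private information is $X_t$, player 2 has no private information, and the common information increment is $Z_{t+1}=(Y_{t+1}^2,U_t^2)$.) Objects indexed by $T+1$ are defined by the same equations. **Beliefs, prescriptions and belief update.** Let $\mathcal S_t=\Delta\mathcal X_t$ (beliefs), $\mathcal B_t^1=\{\text{maps }\mathcal X_t\to\Delta\mathcal U_t^1\}$, $\mathcal B_t^2=\Delta\mathcal U_t^2$ (prescriptions), and write $\gamma^1(x;u)$ for the probability of $u$ under $\gamma^1(x)$. For $z=(y^2,u^2)$ put $$Q_t(\pi,\gamma^1,z;x')=\sum_{x,u^1}\pi(x)\gamma^1(x;u^1)\,\mathbb P[X_{t+1}=x',Y_{t+1}^2=y^2\mid X_t=x,U_t^1=u^1,U_t^2=u^2],\quad R_t(\pi,\gamma^1,z)=\sum_{x'}Q_t(\pi,\gamma^1,z;x').$$ $F_t(\pi,\gamma^1,z)=Q_t(\pi,\gamma^1,z;\cdot)/R_t(\pi,\gamma^1,z)$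 if $R_t(\pi,\gamma^1,z)>0$, and $F_t(\pi,\gamma^1,z)$ is the uniform distribution on $\mathcal X_{t+1}$ otherwise. **Dynamic programs.** Let $\tilde c_t(\pi,\gamma^1,\gamma^2)=\sum_{x,u^1,u^2}c_t(x,u^1,u^2)\pi(x)\gamma^1(x;u^1)\gamma^2(u^2)$. Min-max: $V_{T+1}^u\equiv0$ and for $t\le T$, $\pi_t\in\mathcal S_t$, $\gamma_t^i\in\mathcal B_t^i$, $$w_t^u(\pi_t,\gamma_t^1,\gamma_t^2)=\tilde c_t(\pi_t,\gamma_t^1,\gamma_t^2)+\mathbb E[V_{t+1}^u(F_t(\pi_t,\gamma_t^1,Z_{t+1}))\mid\pi_t,\gamma_t^1,\gamma_t^2],\quad V_t^u(\pi_t)=\inf_{\gamma_t^1\in\mathcal B_t^1}\sup_{\gamma_t^2\in\mathcal B_t^2}w_t^u(\pi_t,\gamma_t^1,\gamma_t^2),$$ where given $(\pi_t,\gamma_t^1,\gamma_t^2)$ the variable $Z_{t+1}$ equals $z=(y^2,u^2)$ with probability $\gamma_t^2(u^2)R_t(\pi_t,\gamma_t^1,z)$. Max-min: $V_{T+1}^l\equiv0$, $w_t^l$ is defined by the same formula with $V_{t+1}^l$ in place of $V_{t+1}^u$, and $V_t^l(\pi_t)=\sup_{\gamma_t^2}\inf_{\gamma_t^1}w_t^l(\pi_t,\gamma_t^1,\gamma_t^2)$. *)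

theory Defs
  imports "HOL-Probability.Probability" "HOL-Library.Function_Algebras"
begin

text \<open>
  Functions into the reals form a real vector space pointwise. Beliefs and prescriptions live in
  such spaces, so that \<open>linear\<close>, \<open>convex\<close> and \<open>convex_on\<close> apply to them.
\<close>

instantiation "fun" :: (type, real_vector) real_vector
begin

definition scaleR_fun :: "real \<Rightarrow> ('a \<Rightarrow> 'b) \<Rightarrow> 'a \<Rightarrow> 'b" where
  "scaleR_fun r f = (\<lambda>x. r *\<^sub>R f x)"

instance
  by standard (auto simp: scaleR_fun_def plus_fun_def fun_eq_iff scaleR_add_right scaleR_add_left)

end

text \<open>
  Finite sets that vary with time are sets over a fixed carrier type. Distributions on \<open>A\<close>
  are mass functions on the carrier type that vanish off \<open>A\<close>.
\<close>

definition simplex_on :: "'a set \<Rightarrow> ('a \<Rightarrow> real) set" where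
  "simplex_on A = {p. (\<forall>a. 0 \<le> p a) \<and> (\<forall>a. a \<notin> A \<longrightarrow> p a = 0) \<and> (\<Sum>a\<in>A. p a) = 1}"

text \<open>
  The polyhedral pieces are cut out of \<open>S\<close> by finitely many affine inequalities.
\<close>

definition piecewise_linear_on :: "'v::real_vector set \<Rightarrow> ('v \<Rightarrow> real) \<Rightarrow> bool" where
  "piecewise_linear_on S f \<longleftrightarrow>
     (\<exists>\<P>. finite \<P> \<and> \<Union>\<P> = S \<and>
        (\<forall>P\<in>\<P>.
           (\<exists>H :: (('v \<Rightarrow> real) \<times> real) set. finite H \<and> (\<forall>(g, b)\<in>H. linear g) \<and>
              P = {v \<in> S. \<forall>(g, b)\<in>H. g v \<le> b}) \<and>
           (\<exists>L. linear L \<and> (\<forall>v\<in>P. f v = L v))))"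

text \<open>
  The primitive random variables \<open>X1 = init_state\<close>, \<open>W\<^sup>s\<^sub>t = state_noise t\<close>,
  \<open>W\<^sup>2\<^sub>t = obs_noise t\<close> are defined on the probability space \<open>space_of\<close>.
  In \<open>obs_map t x u1 u2 w\<close> the state \<open>x\<close> and the noise \<open>w\<close> have time \<open>t\<close> while the
  actions have time \<open>t - 1\<close>.
\<close>

record ('w, 'x, 'u1, 'u2, 'y, 'ws, 'wo) game =
  horizon :: nat
  states :: "nat \<Rightarrow> 'x set"
  actions1 :: "nat \<Rightarrow> 'u1 set"
  actions2 :: "nat \<Rightarrow> 'u2 set"
  observations :: "nat \<Rightarrow> 'y set"
  dynamics :: "nat \<Rightarrow> 'x \<Rightarrow> 'u1 \<Rightarrow> 'u2 \<Rightarrow> 'ws \<Rightarrow> 'x"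
  obs_map :: "nat \<Rightarrow> 'x \<Rightarrow> 'u1 \<Rightarrow> 'u2 \<Rightarrow> 'wo \<Rightarrow> 'y"
  cost :: "nat \<Rightarrow> 'x \<Rightarrow> 'u1 \<Rightarrow> 'u2 \<Rightarrow> real"
  space_of :: "'w measure"
  init_state :: "'w \<Rightarrow> 'x"
  state_noise :: "nat \<Rightarrow> 'w \<Rightarrow> 'ws"
  obs_noise :: "nat \<Rightarrow> 'w \<Rightarrow> 'wo"

text \<open>
  The primitive random variables have different types; the injections into a sum type only serve
  to state their joint independence with \<open>indep_vars\<close>.
\<close>

datatype primitive_index = Init | State_Noise nat | Obs_Noise nat

fun primitive :: "('w, 'x, 'u1, 'u2, 'y, 'ws, 'wo) game \<Rightarrow> primitive_index \<Rightarrow> 'w \<Rightarrow> 'x + 'ws + 'wo"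
where
  "primitive G Init = (\<lambda>\<omega>. Inl (init_state G \<omega>))"
| "primitive G (State_Noise t) = (\<lambda>\<omega>. Inr (Inl (state_noise G t \<omega>)))"
| "primitive G (Obs_Noise t) = (\<lambda>\<omega>. Inr (Inr (obs_noise G t \<omega>)))"

definition primitive_indices :: "('w, 'x, 'u1, 'u2, 'y, 'ws, 'wo) game \<Rightarrow> primitive_index set" where
  "primitive_indices G =
     {Init} \<union> State_Noise ` {1..horizon G} \<union> Obs_Noise ` {2..Suc (horizon G)}"

text \<open>
  \<open>simple_function M X\<close> says that \<open>X\<close> is measurable and takes finitely many values.
\<close>

definition one_sided_game :: "('w, 'x, 'u1, 'u2, 'y, 'ws, 'wo) game \<Rightarrow> bool" where
  "one_sided_game G \<longleftrightarrow>
     (\<forall>t\<in>{1..Suc (horizon G)}. finite (states G t) \<and> states G t \<noteq> {}) \<and>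
     (\<forall>t\<in>{1..horizon G}. finite (actions1 G t) \<and> actions1 G t \<noteq> {} \<and>
                         finite (actions2 G t) \<and> actions2 G t \<noteq> {}) \<and>
     (\<forall>t\<in>{2..Suc (horizon G)}. finite (observations G t)) \<and>
     prob_space (space_of G) \<and>
     (\<forall>i\<in>primitive_indices G. simple_function (space_of G) (primitive G i)) \<and>
     prob_space.indep_vars (space_of G) (\<lambda>_. count_space UNIV) (primitive G) (primitive_indices G) \<and>
     (\<forall>\<omega>\<in>space (space_of G). init_state G \<omega> \<in> states G 1) \<and>
     (\<forall>t\<in>{1..horizon G}. \<forall>x\<in>states G t. \<forall>u1\<in>actions1 G t. \<forall>u2\<in>actions2 G t.
        \<forall>\<omega>\<in>space (space_of G). dynamics G t x u1 u2 (state_noise G t \<omega>) \<in> states G (Suc t)) \<and>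
     (\<forall>t\<in>{1..horizon G}. \<forall>x\<in>states G (Suc t). \<forall>u1\<in>actions1 G t. \<forall>u2\<in>actions2 G t.
        \<forall>\<omega>\<in>space (space_of G).
          obs_map G (Suc t) x u1 u2 (obs_noise G (Suc t) \<omega>) \<in> observations G (Suc t))"

abbreviation beliefs :: "('w, 'x, 'u1, 'u2, 'y, 'ws, 'wo) game \<Rightarrow> nat \<Rightarrow> ('x \<Rightarrow> real) set" where
  "beliefs G t \<equiv> simplex_on (states G t)"

abbreviation prescriptions1 ::
  "('w, 'x, 'u1, 'u2, 'y, 'ws, 'wo) game \<Rightarrow> nat \<Rightarrow> ('x \<Rightarrow> 'u1 \<Rightarrow> real) set" where
  "prescriptions1 G t \<equiv> states G t \<rightarrow>\<^sub>E simplex_on (actions1 G t)"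

abbreviation prescriptions2 ::
  "('w, 'x, 'u1, 'u2, 'y, 'ws, 'wo) game \<Rightarrow> nat \<Rightarrow> ('u2 \<Rightarrow> real) set" where
  "prescriptions2 G t \<equiv> simplex_on (actions2 G t)"

text \<open>
  \<open>kernel G t x u1 u2 x' y\<close> is the probability that \<open>X\<^sub>t\<^sub>+\<^sub>1 = x'\<close> and \<open>Y\<^sub>t\<^sub>+\<^sub>1 = y\<close> given
  \<open>X\<^sub>t = x\<close> and actions \<open>u1\<close>, \<open>u2\<close> at time \<open>t\<close>, read as a transition kernel so that it
  does not depend on strategies and makes sense when the conditioning event is null. The lemma
  \<open>kernel_eq_cond_prob\<close> below relates it to elementary conditional probability: state and
  actions at time \<open>t\<close> are independent of the noises that enter after them.
\<close>

definition kernel ::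
  "('w, 'x, 'u1, 'u2, 'y, 'ws, 'wo) game \<Rightarrow> nat \<Rightarrow> 'x \<Rightarrow> 'u1 \<Rightarrow> 'u2 \<Rightarrow> 'x \<Rightarrow> 'y \<Rightarrow> real" where
  "kernel G t x u1 u2 x' y =
     measure (space_of G) {\<omega> \<in> space (space_of G).
       dynamics G t x u1 u2 (state_noise G t \<omega>) = x' \<and>
       obs_map G (Suc t) x' u1 u2 (obs_noise G (Suc t) \<omega>) = y}"

lemma kernel_eq_cond_prob:
  fixes G :: "('w, 'x, 'u1, 'u2, 'y, 'ws, 'wo) game"
  defines "M \<equiv> space_of G"
  assumes "prob_space M"
    and indep: "prob_space.indep_set M
                  (range (\<lambda>A. (\<lambda>\<omega>. (X \<omega>, U1 \<omega>, U2 \<omega>)) -` A \<inter> space M))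
                  (range (\<lambda>B. (\<lambda>\<omega>. (state_noise G t \<omega>, obs_noise G (Suc t) \<omega>)) -` B \<inter> space M))"
    and next_state: "\<And>\<omega>. X' \<omega> = dynamics G t (X \<omega>) (U1 \<omega>) (U2 \<omega>) (state_noise G t \<omega>)"
    and next_obs: "\<And>\<omega>. Y' \<omega> = obs_map G (Suc t) (X' \<omega>) (U1 \<omega>) (U2 \<omega>) (obs_noise G (Suc t) \<omega>)"
    and pos: "measure M {\<omega> \<in> space M. X \<omega> = x \<and> U1 \<omega> = u1 \<and> U2 \<omega> = u2} > 0"
  shows "cond_prob M (\<lambda>\<omega>. X' \<omega> = x' \<and> Y' \<omega> = y) (\<lambda>\<omega>. X \<omega> = x \<and> U1 \<omega> = u1 \<and> U2 \<omega> = u2)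
           = kernel G t x u1 u2 x' y"
proof -
  interpret prob_space M by fact
  let ?H = "\<lambda>\<omega>. (X \<omega>, U1 \<omega>, U2 \<omega>)"
  let ?N = "\<lambda>\<omega>. (state_noise G t \<omega>, obs_noise G (Suc t) \<omega>)"
  let ?A = "{(x, u1, u2)}"
  let ?B = "{(a, b). dynamics G t x u1 u2 a = x' \<and> obs_map G (Suc t) x' u1 u2 b = y}"
  have "prob ((?H -` ?A \<inter> space M) \<inter> (?N -` ?B \<inter> space M))
      = prob (?H -` ?A \<inter> space M) * prob (?N -` ?B \<inter> space M)"
    by (rule indep_setD[OF indep]) blast+
  moreover have "(?H -` ?A \<inter> space M) \<inter> (?N -` ?B \<inter> space M)
      = {\<omega> \<in> space M. (X' \<omega> = x' \<and> Y' \<omega> = y) \<and> (X \<omega> = x \<and> U1 \<omega> = u1 \<and> U2 \<omega> = u2)}"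
    by (auto simp: next_state next_obs)
  moreover have "?H -` ?A \<inter> space M = {\<omega> \<in> space M. X \<omega> = x \<and> U1 \<omega> = u1 \<and> U2 \<omega> = u2}"
    by auto
  moreover have "?N -` ?B \<inter> space M = {\<omega> \<in> space M. dynamics G t x u1 u2 (state_noise G t \<omega>) = x' \<and>
       obs_map G (Suc t) x' u1 u2 (obs_noise G (Suc t) \<omega>) = y}"
    by auto
  ultimately show ?thesis
    using pos by (simp add: cond_prob_def kernel_def M_def)
qed

definition Q :: "('w, 'x, 'u1, 'u2, 'y, 'ws, 'wo) game \<Rightarrow> nat \<Rightarrow>
    ('x \<Rightarrow> real) \<Rightarrow> ('x \<Rightarrow> 'u1 \<Rightarrow> real) \<Rightarrow> 'y \<times> 'u2 \<Rightarrow> 'x \<Rightarrow> real" where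
  "Q G t \<pi> \<gamma>1 z x' =
     (\<Sum>x\<in>states G t. \<Sum>u1\<in>actions1 G t. \<pi> x * \<gamma>1 x u1 * kernel G t x u1 (snd z) x' (fst z))"

definition R :: "('w, 'x, 'u1, 'u2, 'y, 'ws, 'wo) game \<Rightarrow> nat \<Rightarrow>
    ('x \<Rightarrow> real) \<Rightarrow> ('x \<Rightarrow> 'u1 \<Rightarrow> real) \<Rightarrow> 'y \<times> 'u2 \<Rightarrow> real" where
  "R G t \<pi> \<gamma>1 z = (\<Sum>x'\<in>states G (Suc t). Q G t \<pi> \<gamma>1 z x')"

definition belief_update :: "('w, 'x, 'u1, 'u2, 'y, 'ws, 'wo) game \<Rightarrow> nat \<Rightarrow>
    ('x \<Rightarrow> real) \<Rightarrow> ('x \<Rightarrow> 'u1 \<Rightarrow> real) \<Rightarrow> 'y \<times> 'u2 \<Rightarrow> 'x \<Rightarrow> real" where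
  "belief_update G t \<pi> \<gamma>1 z =
     (if R G t \<pi> \<gamma>1 z > 0 then (\<lambda>x'. Q G t \<pi> \<gamma>1 z x' / R G t \<pi> \<gamma>1 z)
      else (\<lambda>x'. if x' \<in> states G (Suc t) then 1 / card (states G (Suc t)) else 0))"

definition mean_cost :: "('w, 'x, 'u1, 'u2, 'y, 'ws, 'wo) game \<Rightarrow> nat \<Rightarrow>
    ('x \<Rightarrow> real) \<Rightarrow> ('x \<Rightarrow> 'u1 \<Rightarrow> real) \<Rightarrow> ('u2 \<Rightarrow> real) \<Rightarrow> real" where
  "mean_cost G t \<pi> \<gamma>1 \<gamma>2 =
     (\<Sum>x\<in>states G t. \<Sum>u1\<in>actions1 G t. \<Sum>u2\<in>actions2 G t.
        cost G t x u1 u2 * \<pi> x * \<gamma>1 x u1 * \<gamma>2 u2)"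

text \<open>
  One stage of the dynamic program with continuation value \<open>V\<close>; the second summand is the
  expectation of \<open>V (F\<^sub>t (\<pi>, \<gamma>1, Z\<^sub>t\<^sub>+\<^sub>1))\<close>, where \<open>Z\<^sub>t\<^sub>+\<^sub>1 = (y, u2)\<close> has
  probability \<open>\<gamma>2 u2 * R G t \<pi> \<gamma>1 (y, u2)\<close>.
\<close>

definition stage_value :: "('w, 'x, 'u1, 'u2, 'y, 'ws, 'wo) game \<Rightarrow> nat \<Rightarrow> (('x \<Rightarrow> real) \<Rightarrow> real) \<Rightarrow>
    ('x \<Rightarrow> real) \<Rightarrow> ('x \<Rightarrow> 'u1 \<Rightarrow> real) \<Rightarrow> ('u2 \<Rightarrow> real) \<Rightarrow> real" where
  "stage_value G t V \<pi> \<gamma>1 \<gamma>2 =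
     mean_cost G t \<pi> \<gamma>1 \<gamma>2 +
     (\<Sum>z \<in> observations G (Suc t) \<times> actions2 G t.
        \<gamma>2 (snd z) * R G t \<pi> \<gamma>1 z * V (belief_update G t \<pi> \<gamma>1 z))"

text \<open>
  In a \<open>one_sided_game\<close> all stage values over the nonempty prescription sets are bounded, so the
  real-valued \<open>INF\<close> and \<open>SUP\<close> below are genuine infima and suprema.
\<close>

function V_upper :: "('w, 'x, 'u1, 'u2, 'y, 'ws, 'wo) game \<Rightarrow> nat \<Rightarrow> ('x \<Rightarrow> real) \<Rightarrow> real" where
  "V_upper G t =
     (if horizon G < t then (\<lambda>\<pi>. 0)
      else (\<lambda>\<pi>. INF \<gamma>1\<in>prescriptions1 G t. SUP \<gamma>2\<in>prescriptions2 G t.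
                 stage_value G t (V_upper G (Suc t)) \<pi> \<gamma>1 \<gamma>2))"
  by pat_completeness auto
termination by (relation "Wellfounded.measure (\<lambda>(G, t). Suc (horizon G) - t)") auto

function V_lower :: "('w, 'x, 'u1, 'u2, 'y, 'ws, 'wo) game \<Rightarrow> nat \<Rightarrow> ('x \<Rightarrow> real) \<Rightarrow> real" where
  "V_lower G t =
     (if horizon G < t then (\<lambda>\<pi>. 0)
      else (\<lambda>\<pi>. SUP \<gamma>2\<in>prescriptions2 G t. INF \<gamma>1\<in>prescriptions1 G t.
                 stage_value G t (V_lower G (Suc t)) \<pi> \<gamma>1 \<gamma>2))"
  by pat_completeness auto
termination by (relation "Wellfounded.measure (\<lambda>(G, t). Suc (horizon G) - t)") auto

declare V_upper.simps [simp del] V_lower.simps [simp del]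

definition w_upper :: "('w, 'x, 'u1, 'u2, 'y, 'ws, 'wo) game \<Rightarrow> nat \<Rightarrow>
    ('x \<Rightarrow> real) \<Rightarrow> ('x \<Rightarrow> 'u1 \<Rightarrow> real) \<Rightarrow> ('u2 \<Rightarrow> real) \<Rightarrow> real" where
  "w_upper G t = stage_value G t (V_upper G (Suc t))"

definition w_lower :: "('w, 'x, 'u1, 'u2, 'y, 'ws, 'wo) game \<Rightarrow> nat \<Rightarrow>
    ('x \<Rightarrow> real) \<Rightarrow> ('x \<Rightarrow> 'u1 \<Rightarrow> real) \<Rightarrow> ('u2 \<Rightarrow> real) \<Rightarrow> real" where
  "w_lower G t = stage_value G t (V_lower G (Suc t))"

end

theory Submission
  imports Defs
begin

text \<open>
  Suppose that on beliefs the next value function is a maximum of finitely many linear functions.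
  The factor \<open>R\<close> cancels the normalisation in the belief update, so the stage value is a maximum
  over player 2's action and one linear piece per observation of functions that are linear in
  \<open>\<pi> x * \<gamma>1 x u\<close>. This is a matrix game in which player 1 chooses a row after seeing \<open>x\<close>.
  Fourier-Motzkin elimination of player 1's variables produces a finite set of certificates that
  does not depend on \<open>\<pi>\<close>. Each certificate is, up to scaling, a mixed strategy of player 2 together
  with a vector \<open>l\<close> such that the strategy guarantees \<open>\<langle>l, \<pi>\<rangle>\<close>, and the elimination shows that
  player 1 can guarantee the maximum of these numbers. So the stage game has a value, and the
  value is again a maximum of finitely many linear functions.
\<close>

section \<open>Fourier-Motzkin elimination in systems of linear inequalities\<close>

text \<open>Rows with positive \<alpha> bound \<open>s\<close> from above by
  \<open>\<beta> l / \<alpha> l\<close>, rows with negative \<alpha> bound it from below. The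
  hypothesis on pairs says that each lower bound is at most each upper bound, so the largest lower
  bound, if there is one, is a solution.\<close>

lemma one_variable_elimination:
  fixes \<alpha> \<beta> :: "'l \<Rightarrow> real"
  assumes fin: "finite L"
    and zero: "\<And>l. l \<in> L \<Longrightarrow> \<alpha> l = 0 \<Longrightarrow> 0 \<le> \<beta> l"
    and pair: "\<And>l m. l \<in> L \<Longrightarrow> m \<in> L \<Longrightarrow> 0 < \<alpha> l \<Longrightarrow> \<alpha> m < 0 \<Longrightarrow> 0 \<le> \<alpha> l * \<beta> m - \<alpha> m * \<beta> l"
  shows "\<exists>s. \<forall>l\<in>L. \<alpha> l * s \<le> \<beta> l"
proof -
  define P where "P = (\<lambda>l. \<beta> l / \<alpha> l) ` {l \<in> L. 0 < \<alpha> l}"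
  define N where "N = (\<lambda>l. \<beta> l / \<alpha> l) ` {l \<in> L. \<alpha> l < 0}"
  have fP: "finite P" and fN: "finite N"
    using fin by (auto simp: P_def N_def)
  have le: "n \<le> p" if np: "n \<in> N" "p \<in> P" for n p
  proof -
    obtain l where l: "l \<in> L" "0 < \<alpha> l" "p = \<beta> l / \<alpha> l" using np by (auto simp: P_def)
    obtain m where m: "m \<in> L" "\<alpha> m < 0" "n = \<beta> m / \<alpha> m" using np by (auto simp: N_def)
    have "\<beta> l = p * \<alpha> l" "\<beta> m = n * \<alpha> m" using l m by auto
    \<comment> \<open>This is \<open>pair\<close> written in the two quotients; the factor
      \<open>\<alpha> l * \<alpha> m\<close> is negative, which forces
      \<open>n \<le> p\<close>.\<close>
    then have "0 \<le> (\<alpha> l * \<alpha> m) * (n - p)"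
      using pair[OF l(1) m(1) l(2) m(2)] by (simp add: algebra_simps)
    moreover have "\<alpha> l * \<alpha> m < 0" using l m by (simp add: mult_pos_neg)
    ultimately show ?thesis using mult_neg_pos[of "\<alpha> l * \<alpha> m" "n - p"] by linarith
  qed
  have "\<exists>s. (\<forall>n\<in>N. n \<le> s) \<and> (\<forall>p\<in>P. s \<le> p)"
  proof (cases "N = {}")
    case True
    then show ?thesis using fP by (metis Min_le empty_iff)
  next
    case False
    then have "Max N \<in> N" using fN by simp
    then show ?thesis using fN le by (metis Max_ge)
  qed
  then obtain s where s: "\<And>n. n \<in> N \<Longrightarrow> n \<le> s" "\<And>p. p \<in> P \<Longrightarrow> s \<le> p" by blast
  have "\<alpha> l * s \<le> \<beta> l" if "l \<in> L" for l
  proof (cases "\<alpha> l" "0::real" rule: linorder_cases)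
    case less
    then have "\<beta> l / \<alpha> l \<le> s" using that by (intro s) (auto simp: N_def)
    then show ?thesis using less by (simp add: field_simps)
  next
    case equal
    then show ?thesis using zero that by simp
  next
    case greater
    then have "s \<le> \<beta> l / \<alpha> l" using that by (intro s) (auto simp: P_def)
    then show ?thesis using greater by (simp add: field_simps)
  qed
  then show ?thesis by blast
qed

text \<open>
  The finite set of multipliers is chosen before the right-hand side \<open>b\<close>.
\<close>

lemma fourier_motzkin:
  fixes a :: "'i \<Rightarrow> 'n \<Rightarrow> real"
  assumes "finite N" and I: "finite I"
  shows "\<exists>\<Lambda>. finite \<Lambda> \<and>
    (\<forall>c\<in>\<Lambda>. (\<forall>i. 0 \<le> c i) \<and> (\<forall>n\<in>N. (\<Sum>i\<in>I. c i * a i n) = 0)) \<and>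
    (\<forall>b. (\<forall>c\<in>\<Lambda>. 0 \<le> (\<Sum>i\<in>I. c i * b i)) \<longrightarrow> (\<exists>q. \<forall>i\<in>I. (\<Sum>n\<in>N. a i n * q n) \<le> b i))"
  using \<open>finite N\<close>
proof (induction N)
  case empty
  \<comment> \<open>Without variables a system is solvable iff all right-hand sides are nonnegative;
    unit vectors as multipliers express this.\<close>
  define e :: "'i \<Rightarrow> 'i \<Rightarrow> real" where "e i k = of_bool (k = i)" for i k
  have e: "(\<Sum>k\<in>I. e i k * b k) = b i" if "i \<in> I" for i b
    using that I by (simp add: e_def of_bool_def if_distrib[of "\<lambda>z. z * _"] cong: if_cong)
  have "finite (e ` I)" using I by simp
  moreover have "\<forall>c\<in>e ` I. (\<forall>i. 0 \<le> c i) \<and> (\<forall>n\<in>{}. (\<Sum>i\<in>I. c i * a i n) = 0)"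
    by (auto simp: e_def)
  moreover have "\<forall>b. (\<forall>c\<in>e ` I. 0 \<le> (\<Sum>i\<in>I. c i * b i)) \<longrightarrow> (\<exists>q. \<forall>i\<in>I. (\<Sum>n\<in>{}. a i n * q n) \<le> b i)"
    by (simp add: e)
  ultimately show ?case by (intro exI[of _ "e ` I"] conjI)
next
  case (insert n N)
  from insert.IH obtain \<Lambda> where fin: "finite \<Lambda>"
    and \<Lambda>: "\<forall>c\<in>\<Lambda>. (\<forall>i. 0 \<le> c i) \<and> (\<forall>n\<in>N. (\<Sum>i\<in>I. c i * a i n) = 0)"
    and ex: "\<forall>b. (\<forall>c\<in>\<Lambda>. 0 \<le> (\<Sum>i\<in>I. c i * b i)) \<longrightarrow> (\<exists>q. \<forall>i\<in>I. (\<Sum>n\<in>N. a i n * q n) \<le> b i)"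
    by (elim exE conjE) (rule that)
  have nn: "0 \<le> c i" if "c \<in> \<Lambda>" for c i
    using \<Lambda> that by simp
  have z: "(\<Sum>i\<in>I. c i * a i k) = 0" if "c \<in> \<Lambda>" "k \<in> N" for c k
    using \<Lambda> that by simp
  note sol = ex[rule_format]
  \<comment> \<open>\<open>\<alpha> c\<close> is the coefficient of variable \<open>n\<close> in the
    row combined by \<open>c\<close>. If \<open>\<alpha> c > 0 > \<alpha> e\<close>, the mixture of
    \<open>c\<close> and \<open>e\<close> has nonnegative weights and cancels
    \<open>n\<close>.\<close>
  define \<alpha> where "\<alpha> c = (\<Sum>i\<in>I. c i * a i n)" for c
  define mix where "mix = (\<lambda>(c, e) i. \<alpha> c * e i - \<alpha> e * c i)"
  define \<Lambda>' where "\<Lambda>' = {c \<in> \<Lambda>. \<alpha> c = 0} \<union> mix ` {(c, e) \<in> \<Lambda> \<times> \<Lambda>. 0 < \<alpha> c \<and> \<alpha> e < 0}"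
  have mix_sum: "(\<Sum>i\<in>I. mix (c, e) i * b i) = \<alpha> c * (\<Sum>i\<in>I. e i * b i) - \<alpha> e * (\<Sum>i\<in>I. c i * b i)"
    for c e b
    by (simp add: mix_def left_diff_distrib sum_subtractf sum_distrib_left mult.assoc)
  have \<Lambda>'_cases: thesis
    if "c \<in> \<Lambda>'" "c \<in> \<Lambda> \<Longrightarrow> \<alpha> c = 0 \<Longrightarrow> thesis"
      "\<And>c1 c2. c1 \<in> \<Lambda> \<Longrightarrow> c2 \<in> \<Lambda> \<Longrightarrow> 0 < \<alpha> c1 \<Longrightarrow> \<alpha> c2 < 0 \<Longrightarrow> c = mix (c1, c2) \<Longrightarrow> thesis"
    for c thesis
    using that by (auto simp: \<Lambda>'_def)
  have "finite {(c, e) \<in> \<Lambda> \<times> \<Lambda>. 0 < \<alpha> c \<and> \<alpha> e < 0}"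
    by (rule finite_subset[of _ "\<Lambda> \<times> \<Lambda>"]) (use fin in auto)
  then have "finite \<Lambda>'"
    using fin by (simp add: \<Lambda>'_def)
  moreover have "0 \<le> c i" if "c \<in> \<Lambda>'" for c i
  proof (rule \<Lambda>'_cases[OF that])
    fix c1 c2 assume "c1 \<in> \<Lambda>" "c2 \<in> \<Lambda>" "0 < \<alpha> c1" "\<alpha> c2 < 0" "c = mix (c1, c2)"
    moreover from this have "0 \<le> \<alpha> c1 * c2 i" "\<alpha> c2 * c1 i \<le> 0"
      by (simp_all add: nn mult_nonpos_nonneg)
    ultimately show ?thesis by (simp add: mix_def)
  qed (rule nn)
  moreover have "(\<Sum>i\<in>I. c i * a i k) = 0" if "c \<in> \<Lambda>'" "k \<in> insert n N" for c k
  proof (rule \<Lambda>'_cases[OF that(1)])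
    assume "c \<in> \<Lambda>" "\<alpha> c = 0"
    then show ?thesis using that(2) z by (auto simp: \<alpha>_def)
  next
    fix c1 c2 assume c: "c1 \<in> \<Lambda>" "c2 \<in> \<Lambda>" "c = mix (c1, c2)"
    show ?thesis
    proof (cases "k = n")
      case True
      then show ?thesis using c by (simp only: mix_sum \<alpha>_def[symmetric]) simp
    next
      case False
      then show ?thesis using c that(2) by (simp add: mix_sum z)
    qed
  qed
  moreover have "\<exists>q. \<forall>i\<in>I. (\<Sum>n\<in>insert n N. a i n * q n) \<le> b i"
    if b: "\<And>c. c \<in> \<Lambda>' \<Longrightarrow> 0 \<le> (\<Sum>i\<in>I. c i * b i)" for b
  proof -
    \<comment> \<open>A value for variable \<open>n\<close> has to satisfy one inequality per
      multiplier in \<Lambda>. The multipliers with \<open>\<alpha> c = 0\<close> and the mixtures,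
      all members of \<Lambda>', are exactly the two tests for solvability.\<close>
    have "\<exists>s. \<forall>c\<in>\<Lambda>. \<alpha> c * s \<le> (\<Sum>i\<in>I. c i * b i)"
    proof (rule one_variable_elimination[OF fin])
      fix c e assume "c \<in> \<Lambda>" "e \<in> \<Lambda>" "0 < \<alpha> c" "\<alpha> e < 0"
      then have "mix (c, e) \<in> \<Lambda>'" by (auto simp: \<Lambda>'_def)
      from b[OF this] show "0 \<le> \<alpha> c * (\<Sum>i\<in>I. e i * b i) - \<alpha> e * (\<Sum>i\<in>I. c i * b i)"
        by (simp add: mix_sum)
    qed (auto intro: b simp: \<Lambda>'_def)
    then obtain s where s: "\<And>c. c \<in> \<Lambda> \<Longrightarrow> \<alpha> c * s \<le> (\<Sum>i\<in>I. c i * b i)" by blast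
    \<comment> \<open>With \<open>s\<close> moved to the right-hand side, the system in the
      variables \<open>N\<close> passes every test in \<Lambda>.\<close>
    have "0 \<le> (\<Sum>i\<in>I. c i * (b i - a i n * s))" if "c \<in> \<Lambda>" for c
      using s[OF that]
      by (simp add: \<alpha>_def right_diff_distrib sum_subtractf sum_distrib_right mult.assoc)
    from sol[OF this] obtain q where q: "\<And>i. i \<in> I \<Longrightarrow> (\<Sum>n\<in>N. a i n * q n) \<le> b i - a i n * s"
      by auto
    have "(\<Sum>k\<in>insert n N. a i k * (q(n := s)) k) \<le> b i" if "i \<in> I" for i
    proof -
      have "(\<Sum>k\<in>N. a i k * (q(n := s)) k) = (\<Sum>k\<in>N. a i k * q k)"
        using insert.hyps by (intro sum.cong) auto
      then show ?thesis using insert.hyps q[OF that] by simp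
    qed
    then show ?thesis by blast
  qed
  ultimately have "finite \<Lambda>' \<and>
      (\<forall>c\<in>\<Lambda>'. (\<forall>i. 0 \<le> c i) \<and> (\<forall>k\<in>insert n N. (\<Sum>i\<in>I. c i * a i k) = 0)) \<and>
      (\<forall>b. (\<forall>c\<in>\<Lambda>'. 0 \<le> (\<Sum>i\<in>I. c i * b i)) \<longrightarrow>
        (\<exists>q. \<forall>i\<in>I. (\<Sum>k\<in>insert n N. a i k * q k) \<le> b i))"
    by (intro conjI ballI allI impI) simp_all
  then show ?case by (rule exI)
qed

section \<open>Matrix games whose row player observes a state\<close>

text \<open>The unknowns of the elimination are the joint masses
  \<open>q (x, u) = \<pi> x * \<gamma> x u\<close>: the payoffs are linear in them and \<pi> occurs
  only on the right-hand side, so one \<Lambda> serves every \<pi>. A pair \<open>(p, l)\<close>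
  records a mixed strategy and, state by state, a payoff that it guarantees.\<close>

lemma parametrised_matrix_game:
  fixes d :: "'x \<Rightarrow> 'u \<Rightarrow> 'j \<Rightarrow> real"
  assumes X: "finite X" and U: "finite U" "U \<noteq> {}" and J: "finite J" "J \<noteq> {}"
  shows "\<exists>\<Lambda>. finite \<Lambda> \<and> \<Lambda> \<noteq> {} \<and>
    (\<forall>(p, l)\<in>\<Lambda>. p \<in> simplex_on J \<and> (\<forall>x\<in>X. \<forall>u\<in>U. l x \<le> (\<Sum>j\<in>J. p j * d x u j))) \<and>
    (\<forall>\<pi>. (\<forall>x\<in>X. 0 \<le> \<pi> x) \<longrightarrow>
      (\<exists>\<gamma>\<in>X \<rightarrow>\<^sub>E simplex_on U. \<forall>j\<in>J.
        (\<Sum>x\<in>X. \<Sum>u\<in>U. \<pi> x * \<gamma> x u * d x u j) \<le> Max ((\<lambda>(p, l). \<Sum>x\<in>X. l x * \<pi> x) ` \<Lambda>)))"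
proof -
  \<comment> \<open>Four blocks of rows: the payoff against each \<open>j\<close> is at most a
    target, \<open>q\<close> is nonnegative, and two opposite inequalities fix the marginal of
    \<open>q\<close> on \<open>X\<close>.\<close>
  define I :: "('j + ('x \<times> 'u) + 'x + 'x) set" where "I = J <+> ((X \<times> U) <+> (X <+> X))"
  define a :: "('j + ('x \<times> 'u) + 'x + 'x) \<Rightarrow> 'x \<times> 'u \<Rightarrow> real" where
    "a = (\<lambda>i n. case i of Inl j \<Rightarrow> d (fst n) (snd n) j
       | Inr (Inl k) \<Rightarrow> - of_bool (k = n)
       | Inr (Inr (Inl x)) \<Rightarrow> of_bool (x = fst n)
       | Inr (Inr (Inr x)) \<Rightarrow> - of_bool (x = fst n))"
  have mem_I: "Inl j \<in> I \<longleftrightarrow> j \<in> J" "Inr (Inl k) \<in> I \<longleftrightarrow> k \<in> X \<times> U"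
    "Inr (Inr (Inl x)) \<in> I \<longleftrightarrow> x \<in> X" "Inr (Inr (Inr x)) \<in> I \<longleftrightarrow> x \<in> X" for j k x
    by (auto simp: I_def)
  have finI: "finite I" using X U J by (simp add: I_def)
  have sum_I: "(\<Sum>i\<in>I. f i) = (\<Sum>j\<in>J. f (Inl j)) + ((\<Sum>k\<in>X \<times> U. f (Inr (Inl k))) +
      ((\<Sum>x\<in>X. f (Inr (Inr (Inl x)))) + (\<Sum>x\<in>X. f (Inr (Inr (Inr x))))))" for f :: "_ \<Rightarrow> real"
    using X U J by (simp add: I_def sum.Plus)
  have "\<exists>C. finite C \<and>
      (\<forall>c\<in>C. (\<forall>i. 0 \<le> c i) \<and> (\<forall>n\<in>X \<times> U. (\<Sum>i\<in>I. c i * a i n) = 0)) \<and>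
      (\<forall>b. (\<forall>c\<in>C. 0 \<le> (\<Sum>i\<in>I. c i * b i)) \<longrightarrow> (\<exists>q. \<forall>i\<in>I. (\<Sum>n\<in>X \<times> U. a i n * q n) \<le> b i))"
    using X U(1) finI by (intro fourier_motzkin finite_cartesian_product)
  then obtain C where C: "finite C"
    and C_cert: "\<forall>c\<in>C. (\<forall>i. 0 \<le> c i) \<and> (\<forall>n\<in>X \<times> U. (\<Sum>i\<in>I. c i * a i n) = 0)"
    and C_ex: "\<forall>b. (\<forall>c\<in>C. 0 \<le> (\<Sum>i\<in>I. c i * b i)) \<longrightarrow> (\<exists>q. \<forall>i\<in>I. (\<Sum>n\<in>X \<times> U. a i n * q n) \<le> b i)"
    by (elim exE conjE) (rule that)
  have C_nonneg: "0 \<le> c i" if "c \<in> C" for c i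
    using C_cert that by simp
  have C_zero: "(\<Sum>i\<in>I. c i * a i n) = 0" if "c \<in> C" "n \<in> X \<times> U" for c n
    using C_cert that by blast
  note C_sol = C_ex[rule_format]
  \<comment> \<open>\<open>tot c\<close> is the weight of a certificate on the payoff rows,
    \<open>\<nu> c x\<close> its net multiplier of the marginal equation at
    \<open>x\<close>.\<close>
  define tot where "tot c = (\<Sum>j\<in>J. c (Inl j))" for c :: "('j + ('x \<times> 'u) + 'x + 'x) \<Rightarrow> real"
  define \<nu> where "\<nu> c x = c (Inr (Inr (Inl x))) - c (Inr (Inr (Inr x)))"
    for c :: "('j + ('x \<times> 'u) + 'x + 'x) \<Rightarrow> real" and x
  \<comment> \<open>This is column \<open>(x, u)\<close> of the vanishing combination; the
    multiplier of the sign constraint is the slack and makes the left-hand side nonnegative.\<close>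
  have dual: "(\<Sum>j\<in>J. c (Inl j) * d x u j) + \<nu> c x = c (Inr (Inl (x, u)))"
    if "c \<in> C" "x \<in> X" "u \<in> U" for c x u
  proof -
    have "(\<Sum>k\<in>X \<times> U. c (Inr (Inl k)) * of_bool (k = (x, u))) = c (Inr (Inl (x, u)))"
      using X U that by (simp add: of_bool_def if_distrib[of "\<lambda>z. _ * z"] cong: if_cong)
    moreover have "(\<Sum>y\<in>X. g y * of_bool (y = x)) = g x" for g :: "'x \<Rightarrow> real"
      using X that by (simp add: of_bool_def if_distrib[of "\<lambda>z. _ * z"] cong: if_cong)
    ultimately show ?thesis
      using C_zero[of c "(x, u)"] that by (simp add: sum_I a_def \<nu>_def sum_negf)
  qed
  obtain j0 where j0: "j0 \<in> J" using J by blast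
  \<comment> \<open>Division by \<open>tot c\<close> turns the payoff weights into a mixed strategy;
    by \<open>dual\<close>, \<open>- \<nu> c x / tot c\<close> is a payoff that it guarantees at
    \<open>x\<close>.\<close>
  define scaled where "scaled c = (\<lambda>j. if j \<in> J then c (Inl j) / tot c else 0, \<lambda>x. - \<nu> c x / tot c)"
    for c :: "('j + ('x \<times> 'u) + 'x + 'x) \<Rightarrow> real"
  \<comment> \<open>A pure strategy with its worst payoff in each state keeps \<Lambda> nonempty,
    and \<open>Max\<close> meaningful, even if no certificate has positive
    \<open>tot\<close>.\<close>
  define triv :: "('j \<Rightarrow> real) \<times> ('x \<Rightarrow> real)" where
    "triv = (\<lambda>j. of_bool (j = j0), \<lambda>x. Min ((\<lambda>u. d x u j0) ` U))"
  define \<Lambda> where "\<Lambda> = insert triv (scaled ` {c \<in> C. 0 < tot c})"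
  have fin: "finite \<Lambda>" using C by (simp add: \<Lambda>_def)
  have cert: "p \<in> simplex_on J \<and> (\<forall>x\<in>X. \<forall>u\<in>U. l x \<le> (\<Sum>j\<in>J. p j * d x u j))"
    if pl: "(p, l) \<in> \<Lambda>" for p l
  proof (cases "(p, l) = triv")
    case True
    then show ?thesis
      using J j0 U by (simp add: triv_def simplex_on_def of_bool_def if_distrib[of "\<lambda>z. z * _"] cong: if_cong)
  next
    case False
    then obtain c where c: "c \<in> C" "0 < tot c" "(p, l) = scaled c"
      using pl by (auto simp: \<Lambda>_def)
    have "(\<Sum>j\<in>J. c (Inl j) / tot c) = 1"
      using c by (simp add: tot_def flip: sum_divide_distrib)
    moreover have "- \<nu> c x / tot c \<le> (\<Sum>j\<in>J. c (Inl j) / tot c * d x u j)" if "x \<in> X" "u \<in> U" for x u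
    proof -
      have "- \<nu> c x \<le> (\<Sum>j\<in>J. c (Inl j) * d x u j)"
        using dual[OF c(1) that] C_nonneg[OF c(1), of "Inr (Inl (x, u))"] by simp
      then have "- \<nu> c x / tot c \<le> (\<Sum>j\<in>J. c (Inl j) * d x u j) / tot c"
        using c(2) by (intro divide_right_mono) auto
      then show ?thesis by (simp add: sum_divide_distrib)
    qed
    ultimately show ?thesis
      using c C_nonneg[OF c(1)] by (simp add: scaled_def simplex_on_def)
  qed
  have play: "\<exists>\<gamma>\<in>X \<rightarrow>\<^sub>E simplex_on U. \<forall>j\<in>J.
        (\<Sum>x\<in>X. \<Sum>u\<in>U. \<pi> x * \<gamma> x u * d x u j) \<le> Max ((\<lambda>(p, l). \<Sum>x\<in>X. l x * \<pi> x) ` \<Lambda>)"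
    if \<pi>: "\<And>x. x \<in> X \<Longrightarrow> 0 \<le> \<pi> x" for \<pi>
  proof -
    define v where "v = Max ((\<lambda>(p, l). \<Sum>x\<in>X. l x * \<pi> x) ` \<Lambda>)"
    \<comment> \<open>The right-hand sides in block order: the target \<open>v\<close>, zero, and
      \<pi> with both signs.\<close>
    define b :: "('j + ('x \<times> 'u) + 'x + 'x) \<Rightarrow> real" where
      "b = (\<lambda>i. case i of Inl j \<Rightarrow> v | Inr (Inl k) \<Rightarrow> 0
         | Inr (Inr (Inl x)) \<Rightarrow> \<pi> x | Inr (Inr (Inr x)) \<Rightarrow> - \<pi> x)"
    have "0 \<le> (\<Sum>i\<in>I. c i * b i)" if c: "c \<in> C" for c
    proof -
      have eq: "(\<Sum>i\<in>I. c i * b i) = tot c * v + (\<Sum>x\<in>X. \<nu> c x * \<pi> x)"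
        by (simp add: sum_I b_def tot_def \<nu>_def sum_distrib_right left_diff_distrib sum_subtractf sum_negf)
      have "0 \<le> tot c" using C_nonneg[OF c] by (simp add: tot_def sum_nonneg)
      then consider "tot c = 0" | "0 < tot c" by linarith
      then show ?thesis
      proof cases
        \<comment> \<open>Without weight on the payoff rows \<open>dual\<close> reduces to
          nonnegativity of \<open>\<nu> c x\<close>, and \<pi> is nonnegative.\<close>
        case 1
        then have 0: "c (Inl j) = 0" if "j \<in> J" for j
          using J C_nonneg[OF c] that by (simp add: tot_def sum_nonneg_eq_0_iff)
        have "0 \<le> \<nu> c x" if "x \<in> X" for x
          using U dual[OF c that] C_nonneg[OF c] 0 by fastforce
        then show ?thesis using 1 \<pi> by (simp add: eq sum_nonneg)
      next
        \<comment> \<open>The scaled certificate competes in the maximum \<open>v\<close>;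
          multiplication by \<open>tot c\<close> then gives the test.\<close>
        case 2
        then have "scaled c \<in> \<Lambda>" using c by (simp add: \<Lambda>_def)
        then have "(\<Sum>x\<in>X. - \<nu> c x / tot c * \<pi> x) \<le> v"
          unfolding v_def using fin by (intro Max_ge) (auto simp: scaled_def image_iff intro!: bexI[of _ "scaled c"])
        then have "- (\<Sum>x\<in>X. \<nu> c x * \<pi> x) / tot c \<le> v"
          by (simp add: sum_divide_distrib sum_negf)
        then have "0 \<le> tot c * v + (\<Sum>x\<in>X. \<nu> c x * \<pi> x)"
          using 2 by (simp add: field_simps)
        then show ?thesis by (simp only: eq)
      qed
    qed
    from C_sol[OF this] obtain q where q: "\<And>i. i \<in> I \<Longrightarrow> (\<Sum>n\<in>X \<times> U. a i n * q n) \<le> b i" by blast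
    have q_nonneg: "0 \<le> q (x, u)" if "x \<in> X" "u \<in> U" for x u
    proof -
      have "(\<Sum>n\<in>X \<times> U. of_bool ((x, u) = n) * q n) = q (x, u)"
        using X U that by (simp add: of_bool_def if_distrib[of "\<lambda>z. z * _"] cong: if_cong)
      then show ?thesis using q[of "Inr (Inl (x, u))"] that by (simp add: mem_I a_def b_def sum_negf)
    qed
    have q_marg: "(\<Sum>u\<in>U. q (x, u)) = \<pi> x" if "x \<in> X" for x
    proof -
      have "(\<Sum>n\<in>X \<times> U. of_bool (x = fst n) * q n) = (\<Sum>y\<in>X. of_bool (x = y) * (\<Sum>u\<in>U. q (y, u)))"
        by (simp add: sum_distrib_left sum.cartesian_product case_prod_unfold)
      also have "\<dots> = (\<Sum>u\<in>U. q (x, u))"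
        using X U that by (simp add: of_bool_def if_distrib[of "\<lambda>z. z * _"] cong: if_cong)
      finally show ?thesis
        using q[of "Inr (Inr (Inl x))"] q[of "Inr (Inr (Inr x))"] that
        by (simp add: mem_I a_def b_def sum_negf)
    qed
    have q_val: "(\<Sum>x\<in>X. \<Sum>u\<in>U. q (x, u) * d x u j) \<le> v" if "j \<in> J" for j
      using q[of "Inl j"] that
      by (simp add: mem_I a_def b_def sum.cartesian_product case_prod_unfold mult.commute)
    obtain u0 where u0: "u0 \<in> U" using U by blast
    \<comment> \<open>The conditional law of the action given the state. Where
      \<open>\<pi> x = 0\<close> the masses \<open>q (x, u)\<close> vanish as well, and the point
      mass at \<open>u0\<close> serves as a distribution.\<close>
    define \<gamma> where "\<gamma> = (\<lambda>x\<in>X. \<lambda>u. if u \<notin> U then 0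
        else if \<pi> x = 0 then of_bool (u = u0) else q (x, u) / \<pi> x)"
    have \<gamma>: "\<pi> x * \<gamma> x u = q (x, u)" if "x \<in> X" "u \<in> U" for x u
    proof (cases "\<pi> x = 0")
      case True
      then have "q (x, u) = 0"
        using q_marg[OF that(1)] q_nonneg that U by (simp add: sum_nonneg_eq_0_iff)
      then show ?thesis using True by simp
    qed (use that in \<open>simp add: \<gamma>_def\<close>)
    have "\<gamma> \<in> X \<rightarrow>\<^sub>E simplex_on U"
    proof (rule PiE_I)
      fix x assume x: "x \<in> X"
      have "(\<Sum>u\<in>U. q (x, u) / \<pi> x) = 1" if "\<pi> x \<noteq> 0"
        using that q_marg[OF x] by (simp flip: sum_divide_distrib)
      then show "\<gamma> x \<in> simplex_on U"
        using x U u0 q_nonneg \<pi>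
        by (cases "\<pi> x = 0") (auto simp: \<gamma>_def simplex_on_def of_bool_def)
    qed (simp add: \<gamma>_def)
    moreover have "(\<Sum>x\<in>X. \<Sum>u\<in>U. \<pi> x * \<gamma> x u * d x u j) \<le> v" if "j \<in> J" for j
      using q_val[OF that] by (simp add: \<gamma> cong: sum.cong)
    ultimately show ?thesis unfolding v_def by blast
  qed
  have "\<Lambda> \<noteq> {}" by (simp add: \<Lambda>_def)
  moreover have "\<forall>(p, l)\<in>\<Lambda>. p \<in> simplex_on J \<and> (\<forall>x\<in>X. \<forall>u\<in>U. l x \<le> (\<Sum>j\<in>J. p j * d x u j))"
    using cert by blast
  ultimately show ?thesis using fin play by (intro exI[of _ \<Lambda>]) simp
qed

section \<open>Saddle points and iterated extrema\<close>

text \<open>\<open>a\<close> and \<open>b\<close> guarantee the same \<open>v\<close> to the two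
  players, which squeezes both iterated extrema. The bound \<open>K\<close> makes the inner extrema
  range over bounded sets, where the real \<open>INF\<close> and \<open>SUP\<close> are
  genuine.\<close>

lemma saddle_value:
  fixes W :: "'a \<Rightarrow> 'b \<Rightarrow> real"
  assumes a: "a \<in> A" "\<And>y. y \<in> B \<Longrightarrow> W a y \<le> v"
    and b: "b \<in> B" "\<And>x. x \<in> A \<Longrightarrow> v \<le> W x b"
    and K: "\<And>x y. x \<in> A \<Longrightarrow> y \<in> B \<Longrightarrow> \<bar>W x y\<bar> \<le> K"
  shows "(INF x\<in>A. SUP y\<in>B. W x y) = v" and "(SUP y\<in>B. INF x\<in>A. W x y) = v"
proof -
  have above: "bdd_above (W x ` B)" if "x \<in> A" for x
    using K[OF that] by (intro bdd_aboveI2[where M = K]) (simp add: abs_le_iff)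
  have below: "bdd_below ((\<lambda>x. W x y) ` A)" if "y \<in> B" for y
  proof (rule bdd_belowI2[where m = "- K"])
    fix x assume "x \<in> A"
    from K[OF this that] show "- K \<le> W x y" by simp
  qed
  have up: "v \<le> (SUP y\<in>B. W x y)" if "x \<in> A" for x
    using b that above by (intro cSUP_upper2[of _ _ b]) auto
  have low: "(INF x\<in>A. W x y) \<le> v" if "y \<in> B" for y
    using a that below by (intro cINF_lower2[of _ _ a]) auto
  have "(SUP y\<in>B. W a y) \<le> v"
    using a b(1) by (intro cSUP_least) auto
  then have "(INF x\<in>A. SUP y\<in>B. W x y) \<le> v"
    using a(1) up by (intro cINF_lower2[of _ _ a] bdd_belowI2[where m = v]) auto
  moreover have "v \<le> (INF x\<in>A. SUP y\<in>B. W x y)"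
    using a(1) up by (intro cINF_greatest) auto
  ultimately show "(INF x\<in>A. SUP y\<in>B. W x y) = v" by simp
  have "v \<le> (INF x\<in>A. W x b)"
    using a(1) b by (intro cINF_greatest) auto
  then have "v \<le> (SUP y\<in>B. INF x\<in>A. W x y)"
    using b(1) low by (intro cSUP_upper2[of _ _ b] bdd_aboveI2[where M = v]) auto
  moreover have "(SUP y\<in>B. INF x\<in>A. W x y) \<le> v"
    using b(1) low by (intro cSUP_least) auto
  ultimately show "(SUP y\<in>B. INF x\<in>A. W x y) = v" by simp
qed

section \<open>Maxima of finitely many linear functions\<close>

text \<open>The support function of \<open>A\<close> in the coordinates \<open>X\<close>. It accepts
  every vector, not only beliefs, so that it can be evaluated at the unnormalised
  \<open>Q\<close>.\<close>

definition max_linear :: "'a set \<Rightarrow> ('a \<Rightarrow> real) set \<Rightarrow> ('a \<Rightarrow> real) \<Rightarrow> real" where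
  "max_linear X A \<pi> = Max ((\<lambda>l. \<Sum>x\<in>X. l x * \<pi> x) ` A)"

lemma max_linear_ge:
  assumes "finite A" "l \<in> A"
  shows "(\<Sum>x\<in>X. l x * \<pi> x) \<le> max_linear X A \<pi>"
  using assms by (simp add: max_linear_def)

lemma max_linear_attained:
  assumes "finite A" "A \<noteq> {}"
  obtains l where "l \<in> A" "max_linear X A \<pi> = (\<Sum>x\<in>X. l x * \<pi> x)"
proof -
  have "max_linear X A \<pi> \<in> (\<lambda>l. \<Sum>x\<in>X. l x * \<pi> x) ` A"
    unfolding max_linear_def using assms by (intro Max_in) auto
  then show ?thesis using that by blast
qed

text \<open>Multiplication by \<open>r\<close> is monotone and so commutes with \<open>Max\<close>.
  This homogeneity undoes the normalisation in \<open>belief_update\<close>.\<close>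

lemma max_linear_scale:
  assumes A: "finite A" "A \<noteq> {}" and "0 \<le> r"
  shows "max_linear X A (\<lambda>x. r * \<pi> x) = r * max_linear X A \<pi>"
proof -
  have "mono ((*) r)" using \<open>0 \<le> r\<close> by (simp add: mono_def mult_left_mono)
  then have "r * max_linear X A \<pi> = Max ((*) r ` (\<lambda>l. \<Sum>x\<in>X. l x * \<pi> x) ` A)"
    unfolding max_linear_def using A by (intro mono_Max_commute) auto
  then show ?thesis
    by (simp add: max_linear_def image_image sum_distrib_left mult.left_commute)
qed

lemma linear_coordinate_sum: "linear (\<lambda>\<pi>. \<Sum>x\<in>X. l x * \<pi> x)" for l :: "'a \<Rightarrow> real"
  by (rule linearI)
    (simp_all add: plus_fun_def scaleR_fun_def distrib_left sum.distrib sum_distrib_left mult.left_commute)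

text \<open>The vector that attains the maximum at a mixture competes at both end points.\<close>

lemma convex_on_max_linear:
  assumes A: "finite A" "A \<noteq> {}" and S: "convex S"
  shows "convex_on S (max_linear X A)"
proof (rule convex_onI[OF _ S])
  fix t :: real and \<pi> \<rho> assume t: "0 < t" "t < 1"
  obtain l where l: "l \<in> A"
    and eq: "max_linear X A ((1 - t) *\<^sub>R \<pi> + t *\<^sub>R \<rho>) = (\<Sum>x\<in>X. l x * ((1 - t) *\<^sub>R \<pi> + t *\<^sub>R \<rho>) x)"
    by (rule max_linear_attained[OF A])
  have "\<dots> = (1 - t) * (\<Sum>x\<in>X. l x * \<pi> x) + t * (\<Sum>x\<in>X. l x * \<rho> x)"
    by (simp add: plus_fun_def scaleR_fun_def distrib_left sum.distrib sum_distrib_left mult.left_commute)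
  also have "\<dots> \<le> (1 - t) * max_linear X A \<pi> + t * max_linear X A \<rho>"
    using t max_linear_ge[OF A(1) l] by (intro add_mono mult_left_mono) auto
  finally show "max_linear X A ((1 - t) *\<^sub>R \<pi> + t *\<^sub>R \<rho>)
      \<le> (1 - t) * max_linear X A \<pi> + t * max_linear X A \<rho>"
    by (simp only: eq)
qed

text \<open>The cell of \<open>l\<close> consists of the points where \<open>l\<close> is a
  maximiser; it is cut out by comparing \<open>l\<close> with every \<open>k\<close> in
  \<open>A\<close>.\<close>

lemma piecewise_linear_on_max_linear:
  assumes A: "finite A" "A \<noteq> {}"
  shows "piecewise_linear_on S (max_linear X A)"
proof -
  define H where "H l = (\<lambda>k. (\<lambda>\<pi>. \<Sum>x\<in>X. (k x - l x) * \<pi> x, 0 :: real)) ` A" for l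
  define P where "P l = {\<pi> \<in> S. \<forall>(g, b)\<in>H l. g \<pi> \<le> b}" for l
  have P: "\<pi> \<in> P l \<longleftrightarrow> \<pi> \<in> S \<and> (\<forall>k\<in>A. (\<Sum>x\<in>X. k x * \<pi> x) \<le> (\<Sum>x\<in>X. l x * \<pi> x))" for \<pi> l
    by (auto simp: P_def H_def left_diff_distrib sum_subtractf)
  have val: "max_linear X A \<pi> = (\<Sum>x\<in>X. l x * \<pi> x)" if "l \<in> A" "\<pi> \<in> P l" for l \<pi>
    unfolding max_linear_def using that A by (intro Max_eqI) (auto simp: P)
  have "\<exists>l\<in>A. \<pi> \<in> P l" if "\<pi> \<in> S" for \<pi>
  proof -
    obtain l where l: "l \<in> A" "max_linear X A \<pi> = (\<Sum>x\<in>X. l x * \<pi> x)"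
      by (rule max_linear_attained[OF A])
    have "\<pi> \<in> P l"
      using that by (simp add: P l(2)[symmetric] max_linear_ge[OF A(1)])
    then show ?thesis using l(1) by blast
  qed
  then have "\<Union>(P ` A) = S" by (auto simp: P)
  moreover have "\<exists>H' :: ((('a \<Rightarrow> real) \<Rightarrow> real) \<times> real) set. finite H' \<and> (\<forall>(g, b)\<in>H'. linear g) \<and>
      P l = {\<pi> \<in> S. \<forall>(g, b)\<in>H'. g \<pi> \<le> b}" for l
  proof (intro exI conjI)
    show "finite (H l)" using A by (simp add: H_def)
    show "\<forall>(g, b)\<in>H l. linear g"
      using linear_coordinate_sum[of "\<lambda>x. _ x - l x" X] by (auto simp: H_def)
    show "P l = {\<pi> \<in> S. \<forall>(g, b)\<in>H l. g \<pi> \<le> b}" by (rule P_def)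
  qed
  moreover have "\<exists>L. linear L \<and> (\<forall>\<pi>\<in>P l. max_linear X A \<pi> = L \<pi>)" if "l \<in> A" for l
    using linear_coordinate_sum val[OF that] by blast
  ultimately show ?thesis
    unfolding piecewise_linear_on_def using A(1) by (intro exI[of _ "P ` A"]) simp
qed

section \<open>Convexity of the sets of distributions and prescriptions\<close>

lemma convex_simplex_on: "convex (simplex_on A)"
proof (rule convexI)
  fix p q :: "'a \<Rightarrow> real" and u v :: real
  assume *: "p \<in> simplex_on A" "q \<in> simplex_on A" "0 \<le> u" "0 \<le> v" "u + v = 1"
  then have "(\<Sum>a\<in>A. u * p a + v * q a) = 1"
    by (simp add: simplex_on_def sum.distrib flip: sum_distrib_left)
  then show "u *\<^sub>R p + v *\<^sub>R q \<in> simplex_on A"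
    using * by (simp add: simplex_on_def plus_fun_def scaleR_fun_def)
qed

text \<open>Off \<open>X\<close> all members equal \<open>undefined\<close>, and so does a
  combination whose weights sum to one.\<close>

lemma convex_PiE:
  fixes S :: "'b::real_vector set"
  assumes "convex S"
  shows "convex (X \<rightarrow>\<^sub>E S)"
proof (rule convexI)
  fix f g :: "'a \<Rightarrow> 'b" and u v :: real
  assume *: "f \<in> X \<rightarrow>\<^sub>E S" "g \<in> X \<rightarrow>\<^sub>E S" "0 \<le> u" "0 \<le> v" "u + v = 1"
  show "u *\<^sub>R f + v *\<^sub>R g \<in> X \<rightarrow>\<^sub>E S"
  proof (rule PiE_I)
    fix x assume "x \<in> X"
    then have "u *\<^sub>R f x + v *\<^sub>R g x \<in> S"
      by (intro convexD[OF assms] PiE_mem[OF *(1)] PiE_mem[OF *(2)] *(3-5))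
    then show "(u *\<^sub>R f + v *\<^sub>R g) x \<in> S"
      by (simp add: plus_fun_def scaleR_fun_def)
  next
    fix x assume "x \<notin> X"
    then have "f x = undefined" "g x = undefined"
      by (simp_all add: PiE_arb[OF *(1)] PiE_arb[OF *(2)])
    then show "(u *\<^sub>R f + v *\<^sub>R g) x = undefined"
      using \<open>u + v = 1\<close> by (simp add: plus_fun_def scaleR_fun_def flip: scaleR_add_left)
  qed
qed

section \<open>One stage of the game with a maximum of linear functions as continuation
  value\<close>

locale game_stage =
  fixes G :: "('w, 'x, 'u1, 'u2, 'y, 'ws, 'wo) game" and t :: nat
  assumes game: "one_sided_game G" and t: "t \<in> {1..horizon G}"
begin

abbreviation "X \<equiv> states G t"
abbreviation "X' \<equiv> states G (Suc t)"
abbreviation "U1 \<equiv> actions1 G t"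
abbreviation "U2 \<equiv> actions2 G t"
abbreviation "Y \<equiv> observations G (Suc t)"

lemma finite_sets: "finite X" "finite X'" "finite U1" "finite U2" "finite Y"
  using game t by (auto simp: one_sided_game_def)

lemma nonempty_sets: "X' \<noteq> {}" "U1 \<noteq> {}" "U2 \<noteq> {}"
  using game t by (auto simp: one_sided_game_def)

lemma kernel_nonneg: "0 \<le> kernel G t x u1 u2 x' y"
  by (simp add: kernel_def)

lemma kernel_outside:
  assumes "x \<in> X" "u1 \<in> U1" "u2 \<in> U2" "x' \<notin> X'"
  shows "kernel G t x u1 u2 x' y = 0"
proof -
  have "\<forall>\<omega>\<in>space (space_of G). dynamics G t x u1 u2 (state_noise G t \<omega>) \<in> X'"
    using game t assms(1-3) by (simp add: one_sided_game_def)
  then have "{\<omega> \<in> space (space_of G). dynamics G t x u1 u2 (state_noise G t \<omega>) = x' \<and>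
       obs_map G (Suc t) x' u1 u2 (obs_noise G (Suc t) \<omega>) = y} = {}"
    using assms(4) by blast
  then show ?thesis by (simp only: kernel_def measure_empty)
qed

lemma prescription1:
  assumes "\<gamma>1 \<in> prescriptions1 G t" "x \<in> X"
  shows "0 \<le> \<gamma>1 x u" "(\<Sum>u\<in>U1. \<gamma>1 x u) = 1"
  using PiE_mem[OF assms] by (simp_all add: simplex_on_def)

lemma Q_nonneg:
  assumes "\<pi> \<in> beliefs G t" "\<gamma>1 \<in> prescriptions1 G t"
  shows "0 \<le> Q G t \<pi> \<gamma>1 z x'"
  unfolding Q_def using assms prescription1(1)[OF assms(2)]
  by (intro sum_nonneg mult_nonneg_nonneg kernel_nonneg) (auto simp: simplex_on_def)

lemma Q_outside:
  assumes "snd z \<in> U2" "x' \<notin> X'"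
  shows "Q G t \<pi> \<gamma>1 z x' = 0"
  unfolding Q_def using assms by (simp add: kernel_outside)

lemma R_nonneg:
  assumes "\<pi> \<in> beliefs G t" "\<gamma>1 \<in> prescriptions1 G t"
  shows "0 \<le> R G t \<pi> \<gamma>1 z"
  unfolding R_def by (intro sum_nonneg Q_nonneg assms)

lemma belief_update_in_beliefs:
  assumes "\<pi> \<in> beliefs G t" "\<gamma>1 \<in> prescriptions1 G t" "snd z \<in> U2"
  shows "belief_update G t \<pi> \<gamma>1 z \<in> beliefs G (Suc t)"
proof (cases "0 < R G t \<pi> \<gamma>1 z")
  case True
  then have "(\<Sum>x'\<in>X'. Q G t \<pi> \<gamma>1 z x' / R G t \<pi> \<gamma>1 z) = 1"
    by (simp add: R_def flip: sum_divide_distrib)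
  then show ?thesis
    using True Q_nonneg[OF assms(1,2)] Q_outside[OF assms(3)]
    by (simp add: belief_update_def simplex_on_def)
next
  case False
  then show ?thesis
    using finite_sets nonempty_sets by (simp add: belief_update_def simplex_on_def)
qed

text \<open>A positive \<open>R\<close> cancels the normalisation. If \<open>R\<close> is zero, its
  nonnegative summands \<open>Q\<close> all vanish and both sides are zero.\<close>

lemma R_mult_value:
  assumes A: "finite A" "A \<noteq> {}" and V: "\<And>\<rho>. \<rho> \<in> beliefs G (Suc t) \<Longrightarrow> V \<rho> = max_linear X' A \<rho>"
    and \<pi>: "\<pi> \<in> beliefs G t" "\<gamma>1 \<in> prescriptions1 G t" and z: "snd z \<in> U2"
  shows "R G t \<pi> \<gamma>1 z * V (belief_update G t \<pi> \<gamma>1 z) = max_linear X' A (Q G t \<pi> \<gamma>1 z)"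
proof -
  have "R G t \<pi> \<gamma>1 z * V (belief_update G t \<pi> \<gamma>1 z)
      = max_linear X' A (\<lambda>x'. R G t \<pi> \<gamma>1 z * belief_update G t \<pi> \<gamma>1 z x')"
    using R_nonneg[OF \<pi>] by (simp add: V belief_update_in_beliefs \<pi> z max_linear_scale[OF A])
  also have "\<dots> = max_linear X' A (Q G t \<pi> \<gamma>1 z)"
  proof -
    have "R G t \<pi> \<gamma>1 z * belief_update G t \<pi> \<gamma>1 z x' = Q G t \<pi> \<gamma>1 z x'" if "x' \<in> X'" for x'
    proof (cases "0 < R G t \<pi> \<gamma>1 z")
      case False
      then have "R G t \<pi> \<gamma>1 z = 0" using R_nonneg[OF \<pi>, of z] by simp
      moreover from this have "Q G t \<pi> \<gamma>1 z x' = 0"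
        using that finite_sets Q_nonneg[OF \<pi>] by (simp add: R_def sum_nonneg_eq_0_iff)
      ultimately show ?thesis by simp
    qed (simp add: belief_update_def)
    then show ?thesis by (simp add: max_linear_def cong: sum.cong)
  qed
  finally show ?thesis .
qed

text \<open>The payoff when player 2 plays the pure action \<open>u2\<close>; the probabilities of
  the observations are absorbed in the unnormalised \<open>Q\<close>.\<close>

definition action_value :: "('x \<Rightarrow> real) set \<Rightarrow> ('x \<Rightarrow> real) \<Rightarrow> ('x \<Rightarrow> 'u1 \<Rightarrow> real) \<Rightarrow> 'u2 \<Rightarrow> real" where
  "action_value A \<pi> \<gamma>1 u2 =
     (\<Sum>x\<in>X. \<Sum>u1\<in>U1. cost G t x u1 u2 * \<pi> x * \<gamma>1 x u1) +
     (\<Sum>y\<in>Y. max_linear X' A (Q G t \<pi> \<gamma>1 (y, u2)))"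

text \<open>The next belief depends on player 2 only through the realised action, so \<gamma>2
  enters merely as a weight on pure actions.\<close>

lemma stage_value_eq:
  assumes A: "finite A" "A \<noteq> {}" and V: "\<And>\<rho>. \<rho> \<in> beliefs G (Suc t) \<Longrightarrow> V \<rho> = max_linear X' A \<rho>"
    and \<pi>: "\<pi> \<in> beliefs G t" "\<gamma>1 \<in> prescriptions1 G t"
  shows "stage_value G t V \<pi> \<gamma>1 \<gamma>2 = (\<Sum>u2\<in>U2. action_value A \<pi> \<gamma>1 u2 * \<gamma>2 u2)"
proof -
  have "mean_cost G t \<pi> \<gamma>1 \<gamma>2
      = (\<Sum>x\<in>X. \<Sum>u2\<in>U2. \<Sum>u1\<in>U1. cost G t x u1 u2 * \<pi> x * \<gamma>1 x u1 * \<gamma>2 u2)"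
    unfolding mean_cost_def by (rule sum.cong[OF refl], rule sum.swap)
  also have "\<dots> = (\<Sum>u2\<in>U2. \<Sum>x\<in>X. \<Sum>u1\<in>U1. cost G t x u1 u2 * \<pi> x * \<gamma>1 x u1 * \<gamma>2 u2)"
    by (rule sum.swap)
  finally have cost: "mean_cost G t \<pi> \<gamma>1 \<gamma>2
      = (\<Sum>u2\<in>U2. (\<Sum>x\<in>X. \<Sum>u1\<in>U1. cost G t x u1 u2 * \<pi> x * \<gamma>1 x u1) * \<gamma>2 u2)"
    by (simp add: sum_distrib_right)
  have "(\<Sum>z\<in>Y \<times> U2. \<gamma>2 (snd z) * R G t \<pi> \<gamma>1 z * V (belief_update G t \<pi> \<gamma>1 z))
      = (\<Sum>z\<in>Y \<times> U2. max_linear X' A (Q G t \<pi> \<gamma>1 z) * \<gamma>2 (snd z))"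
    by (intro sum.cong) (auto simp: mult.assoc mult.commute[of "\<gamma>2 _"] R_mult_value[OF A V \<pi>])
  also have "\<dots> = (\<Sum>y\<in>Y. \<Sum>u2\<in>U2. max_linear X' A (Q G t \<pi> \<gamma>1 (y, u2)) * \<gamma>2 u2)"
    by (simp add: sum.cartesian_product case_prod_unfold)
  also have "\<dots> = (\<Sum>u2\<in>U2. (\<Sum>y\<in>Y. max_linear X' A (Q G t \<pi> \<gamma>1 (y, u2))) * \<gamma>2 u2)"
    by (subst sum.swap) (simp add: sum_distrib_right)
  finally show ?thesis
    by (simp add: stage_value_def cost action_value_def distrib_right sum.distrib)
qed

text \<open>
  A choice \<open>m\<close> of one vector per observation replaces the continuation value by a linear function;
  player 2 picks \<open>m\<close> together with his action.
\<close>

definition linearised_cost :: "'x \<Rightarrow> 'u1 \<Rightarrow> 'u2 \<times> ('y \<Rightarrow> 'x \<Rightarrow> real) \<Rightarrow> real" where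
  "linearised_cost x u1 = (\<lambda>(u2, m).
     cost G t x u1 u2 + (\<Sum>y\<in>Y. \<Sum>x'\<in>X'. m y x' * kernel G t x u1 u2 x' y))"

definition linearised_value ::
  "('x \<Rightarrow> real) \<Rightarrow> ('x \<Rightarrow> 'u1 \<Rightarrow> real) \<Rightarrow> 'u2 \<times> ('y \<Rightarrow> 'x \<Rightarrow> real) \<Rightarrow> real" where
  "linearised_value \<pi> \<gamma>1 j = (\<Sum>x\<in>X. \<Sum>u1\<in>U1. \<pi> x * \<gamma>1 x u1 * linearised_cost x u1 j)"

lemma linearised_value_eq:
  "linearised_value \<pi> \<gamma>1 (u2, m) =
     (\<Sum>x\<in>X. \<Sum>u1\<in>U1. cost G t x u1 u2 * \<pi> x * \<gamma>1 x u1) +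
     (\<Sum>y\<in>Y. \<Sum>x'\<in>X'. m y x' * Q G t \<pi> \<gamma>1 (y, u2) x')"
proof -
  \<comment> \<open>Pairs \<open>(y, x')\<close> form a single index, so two exchanges of sums
    suffice.\<close>
  let ?k = "\<lambda>x u1 z. m (fst z) (snd z) * kernel G t x u1 u2 (snd z) (fst z)"
  have "(\<Sum>y\<in>Y. \<Sum>x'\<in>X'. m y x' * Q G t \<pi> \<gamma>1 (y, u2) x')
      = (\<Sum>z\<in>Y \<times> X'. m (fst z) (snd z) * Q G t \<pi> \<gamma>1 (fst z, u2) (snd z))"
    by (simp add: sum.cartesian_product case_prod_unfold)
  also have "\<dots> = (\<Sum>z\<in>Y \<times> X'. \<Sum>x\<in>X. \<Sum>u1\<in>U1. \<pi> x * \<gamma>1 x u1 * ?k x u1 z)"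
    by (simp add: Q_def sum_distrib_left mult_ac)
  also have "\<dots> = (\<Sum>x\<in>X. \<Sum>z\<in>Y \<times> X'. \<Sum>u1\<in>U1. \<pi> x * \<gamma>1 x u1 * ?k x u1 z)"
    by (rule sum.swap)
  also have "\<dots> = (\<Sum>x\<in>X. \<Sum>u1\<in>U1. \<Sum>z\<in>Y \<times> X'. \<pi> x * \<gamma>1 x u1 * ?k x u1 z)"
    by (rule sum.cong[OF refl], rule sum.swap)
  also have "\<dots> = (\<Sum>x\<in>X. \<Sum>u1\<in>U1. \<pi> x * \<gamma>1 x u1 * (\<Sum>y\<in>Y. \<Sum>x'\<in>X'. m y x' * kernel G t x u1 u2 x' y))"
    by (intro sum.cong refl) (simp add: sum.cartesian_product case_prod_unfold flip: sum_distrib_left)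
  finally show ?thesis
    by (simp add: linearised_value_def linearised_cost_def distrib_left sum.distrib mult_ac)
qed

lemma linearised_value_le:
  assumes "finite A" "m \<in> Y \<rightarrow>\<^sub>E A"
  shows "linearised_value \<pi> \<gamma>1 (u2, m) \<le> action_value A \<pi> \<gamma>1 u2"
  unfolding linearised_value_eq action_value_def
  using assms by (intro add_left_mono sum_mono max_linear_ge) auto

text \<open>A maximiser is selected at \<open>Q\<close> for each observation separately. With
  \<open>linearised_value_le\<close> this exhibits \<open>action_value\<close> as a maximum over
  \<open>m\<close> of functions linear in \<gamma>1.\<close>

lemma action_value_attained:
  assumes A: "finite A" "A \<noteq> {}"
  obtains m where "m \<in> Y \<rightarrow>\<^sub>E A" "action_value A \<pi> \<gamma>1 u2 = linearised_value \<pi> \<gamma>1 (u2, m)"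
proof -
  have "\<exists>l\<in>A. max_linear X' A \<rho> = (\<Sum>x'\<in>X'. l x' * \<rho> x')" for \<rho>
    by (rule max_linear_attained[OF A, of X' \<rho>]) blast
  then obtain s where s: "\<And>\<rho>. s \<rho> \<in> A" "\<And>\<rho>. max_linear X' A \<rho> = (\<Sum>x'\<in>X'. s \<rho> x' * \<rho> x')"
    by metis
  show ?thesis
  proof (rule that[of "\<lambda>y\<in>Y. s (Q G t \<pi> \<gamma>1 (y, u2))"])
    show "(\<lambda>y\<in>Y. s (Q G t \<pi> \<gamma>1 (y, u2))) \<in> Y \<rightarrow>\<^sub>E A" using s(1) by auto
    show "action_value A \<pi> \<gamma>1 u2 = linearised_value \<pi> \<gamma>1 (u2, \<lambda>y\<in>Y. s (Q G t \<pi> \<gamma>1 (y, u2)))"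
      by (simp add: action_value_def linearised_value_eq s(2) cong: sum.cong)
  qed
qed

lemma linearised_value_combination:
  "linearised_value \<pi> (a *\<^sub>R \<gamma> + b *\<^sub>R \<delta>) j = a * linearised_value \<pi> \<gamma> j + b * linearised_value \<pi> \<delta> j"
  by (simp add: linearised_value_def plus_fun_def scaleR_fun_def sum_distrib_left algebra_simps sum.distrib)

text \<open>The \<open>m\<close> that is optimal at the mixture is admissible at both end points,
  and \<open>linearised_value\<close> is linear in the prescription.\<close>

lemma convex_on_action_value:
  assumes A: "finite A" "A \<noteq> {}"
  shows "convex_on (prescriptions1 G t) (\<lambda>\<gamma>1. action_value A \<pi> \<gamma>1 u2)"
proof (rule convex_onI)
  show "convex (prescriptions1 G t)" by (intro convex_PiE convex_simplex_on)
next
  fix r :: real and \<gamma> \<delta> assume r: "0 < r" "r < 1"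
  obtain m where m: "m \<in> Y \<rightarrow>\<^sub>E A"
    and eq: "action_value A \<pi> ((1 - r) *\<^sub>R \<gamma> + r *\<^sub>R \<delta>) u2
      = linearised_value \<pi> ((1 - r) *\<^sub>R \<gamma> + r *\<^sub>R \<delta>) (u2, m)"
    by (rule action_value_attained[OF A])
  show "action_value A \<pi> ((1 - r) *\<^sub>R \<gamma> + r *\<^sub>R \<delta>) u2
      \<le> (1 - r) * action_value A \<pi> \<gamma> u2 + r * action_value A \<pi> \<delta> u2"
    unfolding eq linearised_value_combination
    using r linearised_value_le[OF A(1) m] by (intro add_mono mult_left_mono) auto
qed

text \<open>Each joint mass \<open>\<pi> x * \<gamma>1 x u1\<close> is at most one. Summation over
  all \<open>j\<close> makes the bound independent of the players' choices, as
  \<open>saddle_value\<close> requires.\<close>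

lemma abs_action_value_le:
  assumes A: "finite A" "A \<noteq> {}" and \<pi>: "\<pi> \<in> beliefs G t" "\<gamma>1 \<in> prescriptions1 G t"
    and u2: "u2 \<in> U2"
  shows "\<bar>action_value A \<pi> \<gamma>1 u2\<bar>
    \<le> (\<Sum>j\<in>U2 \<times> (Y \<rightarrow>\<^sub>E A). \<Sum>x\<in>X. \<Sum>u1\<in>U1. \<bar>linearised_cost x u1 j\<bar>)"
proof -
  obtain m where m: "m \<in> Y \<rightarrow>\<^sub>E A" and eq: "action_value A \<pi> \<gamma>1 u2 = linearised_value \<pi> \<gamma>1 (u2, m)"
    by (rule action_value_attained[OF A])
  have "\<bar>linearised_value \<pi> \<gamma>1 (u2, m)\<bar> \<le> (\<Sum>x\<in>X. \<Sum>u1\<in>U1. \<bar>linearised_cost x u1 (u2, m)\<bar>)"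
    unfolding linearised_value_def
  proof (intro order_trans[OF sum_abs] sum_mono)
    fix x u1 assume x: "x \<in> X" and u1: "u1 \<in> U1"
    have "0 \<le> \<pi> x" "0 \<le> \<gamma>1 x u1" using \<pi> prescription1[OF \<pi>(2) x] by (simp_all add: simplex_on_def)
    moreover have "\<pi> x \<le> 1"
      using \<pi>(1) x finite_sets(1) member_le_sum[of x X \<pi>] by (simp add: simplex_on_def)
    moreover have "\<gamma>1 x u1 \<le> 1"
      using prescription1[OF \<pi>(2) x] u1 finite_sets(3) member_le_sum[of u1 U1 "\<gamma>1 x"] by simp
    ultimately have "\<pi> x * \<gamma>1 x u1 \<le> 1" "0 \<le> \<pi> x * \<gamma>1 x u1" by (simp_all add: mult_le_one)
    then show "\<bar>\<pi> x * \<gamma>1 x u1 * linearised_cost x u1 (u2, m)\<bar> \<le> \<bar>linearised_cost x u1 (u2, m)\<bar>"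
      by (simp add: abs_mult mult_left_le_one_le)
  qed
  also have "\<dots> \<le> (\<Sum>j\<in>U2 \<times> (Y \<rightarrow>\<^sub>E A). \<Sum>x\<in>X. \<Sum>u1\<in>U1. \<bar>linearised_cost x u1 j\<bar>)"
    using u2 m A finite_sets
    by (intro member_le_sum[of "(u2, m)" _ "\<lambda>j. \<Sum>x\<in>X. \<Sum>u1\<in>U1. \<bar>linearised_cost x u1 j\<bar>"])
      (auto intro!: sum_nonneg finite_PiE)
  finally show ?thesis by (simp only: eq)
qed

text \<open>\<open>B\<close> is fixed before \<open>V\<close>, and \<open>V\<close> matters only
  through its values on beliefs, so one \<open>B\<close> serves both dynamic programs.\<close>

lemma stage_has_value:
  assumes A: "finite A" "A \<noteq> {}"
  shows "\<exists>B. finite B \<and> B \<noteq> {} \<and> B \<subseteq> X \<rightarrow>\<^sub>E UNIV \<and>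
    (\<forall>V. (\<forall>\<rho>\<in>beliefs G (Suc t). V \<rho> = max_linear X' A \<rho>) \<longrightarrow>
      (\<forall>\<pi>\<in>beliefs G t.
        (INF \<gamma>1\<in>prescriptions1 G t. SUP \<gamma>2\<in>prescriptions2 G t. stage_value G t V \<pi> \<gamma>1 \<gamma>2)
          = max_linear X B \<pi> \<and>
        (SUP \<gamma>2\<in>prescriptions2 G t. INF \<gamma>1\<in>prescriptions1 G t. stage_value G t V \<pi> \<gamma>1 \<gamma>2)
          = max_linear X B \<pi>))"
proof -
  define M where "M = Y \<rightarrow>\<^sub>E A"
  define J where "J = U2 \<times> M"
  have finM: "finite M" "M \<noteq> {}"
    using A finite_sets by (auto simp: M_def finite_PiE PiE_eq_empty_iff)
  have finJ: "finite J" "J \<noteq> {}"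
    using finM finite_sets nonempty_sets by (auto simp: J_def)
  have "\<exists>\<Lambda>. finite \<Lambda> \<and> \<Lambda> \<noteq> {} \<and>
    (\<forall>(p, l)\<in>\<Lambda>. p \<in> simplex_on J \<and> (\<forall>x\<in>X. \<forall>u\<in>U1. l x \<le> (\<Sum>j\<in>J. p j * linearised_cost x u j))) \<and>
    (\<forall>\<pi>. (\<forall>x\<in>X. 0 \<le> \<pi> x) \<longrightarrow>
      (\<exists>\<gamma>\<in>X \<rightarrow>\<^sub>E simplex_on U1. \<forall>j\<in>J.
        (\<Sum>x\<in>X. \<Sum>u\<in>U1. \<pi> x * \<gamma> x u * linearised_cost x u j)
          \<le> Max ((\<lambda>(p, l). \<Sum>x\<in>X. l x * \<pi> x) ` \<Lambda>)))"
    by (intro parametrised_matrix_game finite_sets nonempty_sets finJ)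
  then obtain \<Lambda> where \<Lambda>: "finite \<Lambda>" "\<Lambda> \<noteq> {}"
    and cert: "\<forall>(p, l)\<in>\<Lambda>. p \<in> simplex_on J \<and> (\<forall>x\<in>X. \<forall>u\<in>U1. l x \<le> (\<Sum>j\<in>J. p j * linearised_cost x u j))"
    and play: "\<forall>\<pi>. (\<forall>x\<in>X. 0 \<le> \<pi> x) \<longrightarrow>
      (\<exists>\<gamma>\<in>X \<rightarrow>\<^sub>E simplex_on U1. \<forall>j\<in>J.
        (\<Sum>x\<in>X. \<Sum>u\<in>U1. \<pi> x * \<gamma> x u * linearised_cost x u j)
          \<le> Max ((\<lambda>(p, l). \<Sum>x\<in>X. l x * \<pi> x) ` \<Lambda>))"
    by (elim exE conjE) (rule that)
  \<comment> \<open>Restriction yields vectors indexed by the states alone and leaves the sums over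
    \<open>X\<close> unchanged.\<close>
  define B where "B = (\<lambda>(p, l). restrict l X) ` \<Lambda>"
  have B: "finite B" "B \<noteq> {}" "B \<subseteq> X \<rightarrow>\<^sub>E UNIV"
    using \<Lambda> by (auto simp: B_def)
  have B_max: "max_linear X B \<pi> = Max ((\<lambda>(p, l). \<Sum>x\<in>X. l x * \<pi> x) ` \<Lambda>)" for \<pi>
    by (simp add: max_linear_def B_def image_image case_prod_unfold cong: sum.cong)
  have "(INF \<gamma>1\<in>prescriptions1 G t. SUP \<gamma>2\<in>prescriptions2 G t. stage_value G t V \<pi> \<gamma>1 \<gamma>2)
          = max_linear X B \<pi> \<and>
        (SUP \<gamma>2\<in>prescriptions2 G t. INF \<gamma>1\<in>prescriptions1 G t. stage_value G t V \<pi> \<gamma>1 \<gamma>2)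
          = max_linear X B \<pi>"
    if V: "\<And>\<rho>. \<rho> \<in> beliefs G (Suc t) \<Longrightarrow> V \<rho> = max_linear X' A \<rho>" and \<pi>: "\<pi> \<in> beliefs G t" for V \<pi>
  proof -
    note val = stage_value_eq[OF A V \<pi>]
    have \<pi>_nonneg: "0 \<le> \<pi> x" for x using \<pi> by (simp add: simplex_on_def)
    then obtain \<gamma> where \<gamma>: "\<gamma> \<in> prescriptions1 G t"
      and \<gamma>_le: "\<And>j. j \<in> J \<Longrightarrow> linearised_value \<pi> \<gamma> j \<le> max_linear X B \<pi>"
      using play[rule_format, of \<pi>] unfolding B_max linearised_value_def by blast
    \<comment> \<open>A certificate that attains the maximum at this \<pi> supplies an optimal
      strategy for player 2.\<close>
    have "Max ((\<lambda>(p, l). \<Sum>x\<in>X. l x * \<pi> x) ` \<Lambda>) \<in> (\<lambda>(p, l). \<Sum>x\<in>X. l x * \<pi> x) ` \<Lambda>"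
      using \<Lambda> by (intro Max_in) auto
    then obtain p l where pl: "(p, l) \<in> \<Lambda>" and l_eq: "max_linear X B \<pi> = (\<Sum>x\<in>X. l x * \<pi> x)"
      unfolding B_max by auto
    have p: "p \<in> simplex_on J"
      and l_le: "\<And>x u. x \<in> X \<Longrightarrow> u \<in> U1 \<Longrightarrow> l x \<le> (\<Sum>j\<in>J. p j * linearised_cost x u j)"
      using bspec[OF cert pl] by auto
    \<comment> \<open>The component \<open>m\<close> only encodes the continuation value and is no
      move of player 2; the marginal of \<open>p\<close> on actions is a prescription.\<close>
    define \<delta> where "\<delta> u2 = (\<Sum>m\<in>M. p (u2, m))" for u2
    have \<delta>: "\<delta> \<in> prescriptions2 G t"
    proof -
      have "(\<Sum>u2\<in>U2. \<delta> u2) = (\<Sum>j\<in>J. p j)"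
        by (simp add: \<delta>_def J_def sum.cartesian_product)
      then show ?thesis using p by (auto simp: simplex_on_def \<delta>_def J_def intro: sum_nonneg)
    qed
    have upper: "stage_value G t V \<pi> \<gamma> \<gamma>2 \<le> max_linear X B \<pi>" if \<gamma>2: "\<gamma>2 \<in> prescriptions2 G t" for \<gamma>2
    proof -
      have "action_value A \<pi> \<gamma> u2 \<le> max_linear X B \<pi>" if "u2 \<in> U2" for u2
        by (rule action_value_attained[OF A, of \<pi> \<gamma> u2]) (use \<gamma>_le that in \<open>auto simp: J_def M_def\<close>)
      then have "(\<Sum>u2\<in>U2. action_value A \<pi> \<gamma> u2 * \<gamma>2 u2) \<le> (\<Sum>u2\<in>U2. max_linear X B \<pi> * \<gamma>2 u2)"
        using \<gamma>2 by (intro sum_mono mult_right_mono) (auto simp: simplex_on_def)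
      also have "\<dots> = max_linear X B \<pi>"
        using \<gamma>2 by (simp add: simplex_on_def flip: sum_distrib_left)
      finally show ?thesis by (simp add: val \<gamma>)
    qed
    have lower: "max_linear X B \<pi> \<le> stage_value G t V \<pi> \<gamma>1 \<delta>" if \<gamma>1: "\<gamma>1 \<in> prescriptions1 G t" for \<gamma>1
    proof -
      note \<gamma>1_x = prescription1[OF \<gamma>1]
      \<comment> \<open>\<open>\<gamma>1 x\<close> has mass one, so \<open>l x\<close> can be
        averaged over the actions and then compared row by row.\<close>
      have "max_linear X B \<pi> = (\<Sum>x\<in>X. \<Sum>u1\<in>U1. \<pi> x * \<gamma>1 x u1 * l x)"
        by (simp add: l_eq \<gamma>1_x mult.commute flip: sum_distrib_left sum_distrib_right cong: sum.cong)
      also have "\<dots> \<le> (\<Sum>x\<in>X. \<Sum>u1\<in>U1. \<pi> x * \<gamma>1 x u1 * (\<Sum>j\<in>J. p j * linearised_cost x u1 j))"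
        using \<gamma>1_x \<pi>_nonneg l_le by (intro sum_mono mult_left_mono) auto
      also have "\<dots> = (\<Sum>x\<in>X. \<Sum>u1\<in>U1. \<Sum>j\<in>J. p j * (\<pi> x * \<gamma>1 x u1 * linearised_cost x u1 j))"
        by (simp add: sum_distrib_left mult_ac)
      also have "\<dots> = (\<Sum>x\<in>X. \<Sum>j\<in>J. \<Sum>u1\<in>U1. p j * (\<pi> x * \<gamma>1 x u1 * linearised_cost x u1 j))"
        by (rule sum.cong[OF refl], rule sum.swap)
      also have "\<dots> = (\<Sum>j\<in>J. \<Sum>x\<in>X. \<Sum>u1\<in>U1. p j * (\<pi> x * \<gamma>1 x u1 * linearised_cost x u1 j))"
        by (rule sum.swap)
      also have "\<dots> = (\<Sum>j\<in>J. p j * linearised_value \<pi> \<gamma>1 j)"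
        by (simp add: linearised_value_def sum_distrib_left)
      \<comment> \<open>Each \<open>m\<close> is replaced by the best reply to \<gamma>1; then only
        the action matters and \<open>p\<close> collapses to \<delta>.\<close>
      also have "\<dots> \<le> (\<Sum>j\<in>J. p j * action_value A \<pi> \<gamma>1 (fst j))"
        using p linearised_value_le[OF A(1)]
        by (intro sum_mono mult_left_mono) (auto simp: J_def M_def simplex_on_def)
      also have "\<dots> = (\<Sum>u2\<in>U2. \<Sum>m\<in>M. p (u2, m) * action_value A \<pi> \<gamma>1 u2)"
        by (simp add: J_def sum.cartesian_product case_prod_unfold)
      also have "\<dots> = (\<Sum>u2\<in>U2. action_value A \<pi> \<gamma>1 u2 * \<delta> u2)"
        by (simp add: \<delta>_def sum_distrib_right mult.commute)
      finally show ?thesis by (simp add: val \<gamma>1)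
    qed
    have bound: "\<bar>stage_value G t V \<pi> \<gamma>1 \<gamma>2\<bar>
        \<le> (\<Sum>j\<in>J. \<Sum>x\<in>X. \<Sum>u1\<in>U1. \<bar>linearised_cost x u1 j\<bar>)" (is "_ \<le> ?K")
      if \<gamma>1: "\<gamma>1 \<in> prescriptions1 G t" and \<gamma>2: "\<gamma>2 \<in> prescriptions2 G t" for \<gamma>1 \<gamma>2
    proof -
      have "\<bar>\<Sum>u2\<in>U2. action_value A \<pi> \<gamma>1 u2 * \<gamma>2 u2\<bar> \<le> (\<Sum>u2\<in>U2. ?K * \<gamma>2 u2)"
      proof (intro order_trans[OF sum_abs] sum_mono)
        fix u2 assume "u2 \<in> U2"
        then have "\<bar>action_value A \<pi> \<gamma>1 u2\<bar> \<le> ?K"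
          unfolding J_def M_def by (rule abs_action_value_le[OF A \<pi> \<gamma>1])
        moreover have "0 \<le> \<gamma>2 u2" using \<gamma>2 by (simp add: simplex_on_def)
        ultimately show "\<bar>action_value A \<pi> \<gamma>1 u2 * \<gamma>2 u2\<bar> \<le> ?K * \<gamma>2 u2"
          by (simp add: abs_mult mult_right_mono)
      qed
      also have "\<dots> = ?K" using \<gamma>2 by (simp add: simplex_on_def flip: sum_distrib_left)
      finally show ?thesis by (simp add: val \<gamma>1)
    qed
    show ?thesis
      using saddle_value[where W = "stage_value G t V \<pi>", OF \<gamma> upper \<delta> lower bound] by blast
  qed
  then have "\<forall>V. (\<forall>\<rho>\<in>beliefs G (Suc t). V \<rho> = max_linear X' A \<rho>) \<longrightarrow>
      (\<forall>\<pi>\<in>beliefs G t.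
        (INF \<gamma>1\<in>prescriptions1 G t. SUP \<gamma>2\<in>prescriptions2 G t. stage_value G t V \<pi> \<gamma>1 \<gamma>2)
          = max_linear X B \<pi> \<and>
        (SUP \<gamma>2\<in>prescriptions2 G t. INF \<gamma>1\<in>prescriptions1 G t. stage_value G t V \<pi> \<gamma>1 \<gamma>2)
          = max_linear X B \<pi>)"
    by (intro allI impI ballI) simp
  with B show ?thesis by (intro exI[of _ B] conjI)
qed

end

section \<open>Backward induction over time\<close>

text \<open>Both value functions go through one induction with a common \<open>A\<close>, which
  yields their equality as well. Time \<open>Suc (horizon G)\<close> is included because a stage
  refers to the value one step later.\<close>

lemma value_functions_max_linear:
  fixes G :: "('w, 'x, 'u1, 'u2, 'y, 'ws, 'wo) game"
  assumes game: "one_sided_game G" and t: "t \<in> {1..Suc (horizon G)}"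
  shows "\<exists>A. finite A \<and> A \<noteq> {} \<and> A \<subseteq> states G t \<rightarrow>\<^sub>E UNIV \<and>
    (\<forall>\<pi>\<in>beliefs G t. V_upper G t \<pi> = max_linear (states G t) A \<pi> \<and>
                      V_lower G t \<pi> = max_linear (states G t) A \<pi>)"
proof -
  have "t \<le> Suc (horizon G)" using t by simp
  then show ?thesis using t
  proof (induction t rule: inc_induct)
    case base
    \<comment> \<open>After the horizon the values are zero, represented by the zero vector
      restricted to the states.\<close>
    show ?case
      by (intro exI[of _ "{\<lambda>x\<in>states G (Suc (horizon G)). 0}"])
        (simp add: V_upper.simps V_lower.simps max_linear_def cong: sum.cong)
  next
    case (step n)
    then have n: "n \<in> {1..horizon G}" by simp
    interpret game_stage G n using game n by unfold_locales
    obtain A where A: "finite A" "A \<noteq> {}"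
      and val: "\<And>\<pi>. \<pi> \<in> beliefs G (Suc n) \<Longrightarrow> V_upper G (Suc n) \<pi> = max_linear X' A \<pi>"
               "\<And>\<pi>. \<pi> \<in> beliefs G (Suc n) \<Longrightarrow> V_lower G (Suc n) \<pi> = max_linear X' A \<pi>"
      using step.IH n by auto
    from stage_has_value[OF A] obtain B where B: "finite B" "B \<noteq> {}" "B \<subseteq> X \<rightarrow>\<^sub>E UNIV"
      and BV: "\<forall>V. (\<forall>\<rho>\<in>beliefs G (Suc n). V \<rho> = max_linear X' A \<rho>) \<longrightarrow>
      (\<forall>\<pi>\<in>beliefs G n.
        (INF \<gamma>1\<in>prescriptions1 G n. SUP \<gamma>2\<in>prescriptions2 G n. stage_value G n V \<pi> \<gamma>1 \<gamma>2)
          = max_linear X B \<pi> \<and>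
        (SUP \<gamma>2\<in>prescriptions2 G n. INF \<gamma>1\<in>prescriptions1 G n. stage_value G n V \<pi> \<gamma>1 \<gamma>2)
          = max_linear X B \<pi>)"
      by (elim exE conjE) (rule that)
    \<comment> \<open>\<open>BV\<close> is applied to each continuation value: the first half of its
      conclusion serves \<open>V_upper\<close>, the second \<open>V_lower\<close>.\<close>
    have "V_upper G n \<pi> = max_linear X B \<pi> \<and> V_lower G n \<pi> = max_linear X B \<pi>" if "\<pi> \<in> beliefs G n" for \<pi>
      using n that BV[rule_format, of "V_upper G (Suc n)" \<pi>] BV[rule_format, of "V_lower G (Suc n)" \<pi>]
      by (simp add: val V_upper.simps[of G n] V_lower.simps[of G n])
    with B show ?case by (intro exI[of _ B]) blast
  qed
qed

section \<open>Convexity of weighted sums and the claims at a fixed time\<close>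

lemma convex_on_cong_value:
  assumes "convex_on S f" "\<And>x. x \<in> S \<Longrightarrow> f x = g x"
  shows "convex_on S g"
  using assms convexD[of S] by (simp add: convex_on_def)

lemma convex_on_finite_sum:
  fixes f :: "'i \<Rightarrow> 'v::real_vector \<Rightarrow> real"
  assumes "finite I" "convex S" "\<And>i. i \<in> I \<Longrightarrow> convex_on S (f i)"
  shows "convex_on S (\<lambda>x. \<Sum>i\<in>I. f i x)"
  using assms(1,3)
  by (induction I) (simp_all add: assms(2) convex_on_const convex_on_add)

theorem lemma9:
  fixes G :: "('w, 'x, 'u1, 'u2, 'y, 'ws, 'wo) game" and t :: nat
  assumes "one_sided_game G"
    and "t \<in> {1..horizon G}"
  shows
    "(\<forall>\<pi>\<in>beliefs G t. V_upper G t \<pi> = V_lower G t \<pi>) \<and>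
     (\<forall>\<pi>\<in>beliefs G t. \<forall>\<gamma>1\<in>prescriptions1 G t. \<forall>\<gamma>2\<in>prescriptions2 G t.
        w_upper G t \<pi> \<gamma>1 \<gamma>2 = w_lower G t \<pi> \<gamma>1 \<gamma>2) \<and>
     (\<exists>\<A> :: ('x \<Rightarrow> real) set. finite \<A> \<and> \<A> \<noteq> {} \<and> \<A> \<subseteq> states G t \<rightarrow>\<^sub>E UNIV \<and>
        (\<forall>\<pi>\<in>beliefs G t. V_upper G t \<pi> = Max ((\<lambda>l. \<Sum>x\<in>states G t. l x * \<pi> x) ` \<A>))) \<and>
     piecewise_linear_on (beliefs G t) (V_upper G t) \<and>
     convex_on (beliefs G t) (V_upper G t) \<and>
     (\<forall>\<pi>\<in>beliefs G t. \<forall>\<gamma>1\<in>prescriptions1 G t.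
        \<exists>L. linear L \<and> (\<forall>\<gamma>2\<in>prescriptions2 G t. w_upper G t \<pi> \<gamma>1 \<gamma>2 = L \<gamma>2)) \<and>
     (\<forall>\<pi>\<in>beliefs G t. \<forall>\<gamma>2\<in>prescriptions2 G t.
        convex_on (prescriptions1 G t) (\<lambda>\<gamma>1. w_upper G t \<pi> \<gamma>1 \<gamma>2))"
proof -
  interpret game_stage G t using assms by unfold_locales
  obtain A where A: "finite A" "A \<noteq> {}" "A \<subseteq> X \<rightarrow>\<^sub>E UNIV"
    and VA: "\<And>\<pi>. \<pi> \<in> beliefs G t \<Longrightarrow> V_upper G t \<pi> = max_linear X A \<pi>"
            "\<And>\<pi>. \<pi> \<in> beliefs G t \<Longrightarrow> V_lower G t \<pi> = max_linear X A \<pi>"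
    using value_functions_max_linear[of G t] assms by auto
  \<comment> \<open>The representation one step later describes \<open>w_upper\<close> and
    \<open>w_lower\<close> by the same expression.\<close>
  obtain A' where A': "finite A'" "A' \<noteq> {}"
    and VA': "\<And>\<pi>. \<pi> \<in> beliefs G (Suc t) \<Longrightarrow> V_upper G (Suc t) \<pi> = max_linear X' A' \<pi>"
             "\<And>\<pi>. \<pi> \<in> beliefs G (Suc t) \<Longrightarrow> V_lower G (Suc t) \<pi> = max_linear X' A' \<pi>"
    using value_functions_max_linear[of G "Suc t"] assms by auto
  have w: "w_upper G t \<pi> \<gamma>1 \<gamma>2 = (\<Sum>u2\<in>U2. action_value A' \<pi> \<gamma>1 u2 * \<gamma>2 u2)"
          "w_lower G t \<pi> \<gamma>1 \<gamma>2 = (\<Sum>u2\<in>U2. action_value A' \<pi> \<gamma>1 u2 * \<gamma>2 u2)"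
    if "\<pi> \<in> beliefs G t" "\<gamma>1 \<in> prescriptions1 G t" for \<pi> \<gamma>1 \<gamma>2
    unfolding w_upper_def w_lower_def using that by (auto intro: stage_value_eq[OF A'] VA')
  have "piecewise_linear_on (beliefs G t) (V_upper G t)"
  proof -
    \<comment> \<open>\<open>V_upper\<close> agrees with the maximum on beliefs only; the cells lie
      inside the belief simplex, so the decomposition carries over.\<close>
    obtain \<P> where \<P>: "finite \<P>" "\<Union>\<P> = beliefs G t"
      "\<forall>P\<in>\<P>.
           (\<exists>H :: ((('x \<Rightarrow> real) \<Rightarrow> real) \<times> real) set. finite H \<and> (\<forall>(g, b)\<in>H. linear g) \<and>
              P = {v \<in> beliefs G t. \<forall>(g, b)\<in>H. g v \<le> b}) \<and>
           (\<exists>L. linear L \<and> (\<forall>v\<in>P. max_linear X A v = L v))"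
      using piecewise_linear_on_max_linear[OF A(1,2), of "beliefs G t" X]
      unfolding piecewise_linear_on_def by (elim exE conjE) (rule that)
    have "max_linear X A v = V_upper G t v" if "P \<in> \<P>" "v \<in> P" for P v
    proof -
      have "v \<in> beliefs G t" using \<P>(2) that by blast
      then show ?thesis by (simp add: VA(1))
    qed
    then show ?thesis
      unfolding piecewise_linear_on_def using \<P> by (intro exI[of _ \<P>]) simp
  qed
  moreover have "convex_on (beliefs G t) (V_upper G t)"
    using convex_on_max_linear[OF A(1,2) convex_simplex_on] by (rule convex_on_cong_value) (simp add: VA)
  moreover have "convex_on (prescriptions1 G t) (\<lambda>\<gamma>1. w_upper G t \<pi> \<gamma>1 \<gamma>2)"
    if \<pi>: "\<pi> \<in> beliefs G t" and \<gamma>2: "\<gamma>2 \<in> prescriptions2 G t" for \<pi> \<gamma>2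
  proof (rule convex_on_cong_value)
    \<comment> \<open>The weights \<open>\<gamma>2 u2\<close> are nonnegative, so convexity passes
      from the single actions to the sum.\<close>
    show "convex_on (prescriptions1 G t) (\<lambda>\<gamma>1. \<Sum>u2\<in>U2. \<gamma>2 u2 * action_value A' \<pi> \<gamma>1 u2)"
      using \<gamma>2
      by (intro convex_on_finite_sum convex_on_cmul convex_on_action_value A' finite_sets
          convex_PiE convex_simplex_on) (simp add: simplex_on_def)
  qed (simp add: w \<pi> mult.commute)
  moreover have "\<exists>L. linear L \<and> (\<forall>\<gamma>2\<in>prescriptions2 G t. w_upper G t \<pi> \<gamma>1 \<gamma>2 = L \<gamma>2)"
    if "\<pi> \<in> beliefs G t" "\<gamma>1 \<in> prescriptions1 G t" for \<pi> \<gamma>1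
    using linear_coordinate_sum[of "action_value A' \<pi> \<gamma>1" U2] w(1)[OF that] by blast
  moreover have "\<exists>\<A> :: ('x \<Rightarrow> real) set. finite \<A> \<and> \<A> \<noteq> {} \<and> \<A> \<subseteq> X \<rightarrow>\<^sub>E UNIV \<and>
        (\<forall>\<pi>\<in>beliefs G t. V_upper G t \<pi> = Max ((\<lambda>l. \<Sum>x\<in>X. l x * \<pi> x) ` \<A>))"
    using A VA(1) by (auto simp: max_linear_def)
  ultimately show ?thesis by (simp add: VA w)
qed

end
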